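(* Let $\Omega$ be a class of $C^*$-algebras and let $A$ be a $C^*$-algebra. If $A$ and all algebras in $\Omega$ are unital, then $A \in \mathrm{WTA}\Omega$ if and only if $A \in \mathrm{GTA}\Omega$.
   Context: Notation. For a $C^*$-algebra $A$, $A_+$ denotes its set of positive elements. For $x \in A$, a subset $B \subset A$ and $\epsilon>0$, $x \in_{\epsilon} B$ means that there is $b \in B$ with $\|x-b\|<\epsilon$. For $a \in A_+$ and $\epsilon > 0$, $(a-\epsilon)_+$ is the element obtained by applying the function $t \mapsto \max\{t-\epsilon,0\}$ to $a$ by continuous functional calculus. For $a,b\in A_+$, $a \precsim_A b$ denotes Cuntz subequivalence in $A$: there is a sequence $(v_n)$ in $A$ with $\|v_n b v_n^* - a\| \to 0$. The unit of a $C^*$-subalgebra $B \subset A$ (when it exists) is denoted $1_B$ and need not equal $1_A$. Definition of $\mathrm{WTA}\Omega$. Let $\Omega$ be a class of unital $C^*$-algebras. A simple unital $C^*$-algebra $A$ belongs to the class $\mathrm{WTA}\Omega$ if, for any $\epsilon > 0$, any finite subset $F \subset A$, and any non-zero element $a \in A_+$, there exist a $C^*$-subalgebra $B \subset A$ with $B \in \Omega$, a projection $p \in A$ with $p = 1_B$, and an element $g \in B_+$ with $0 \leq g \leq 1$, such that (1) $(p-g)x \in_{\epsilon} B$ and $x(p-g) \in_{\epsilon} B$ for all $x \in F$; (2) $\| (p-g)x - x(p-g)\| < \epsilon$ for all $x \in F$; (3) $1_A - (p-g) \precsim_A a$; and (4) $\| (p-g)a(p-g)\| \geq \|a\| - \epsilon$.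 Definition of $\mathrm{GTA}\Omega$. Let $\Omega$ be a class of $C^*$-algebras. A simple $C^*$-algebra $A$ belongs to the class $\mathrm{GTA}\Omega$ if, for any $\epsilon > 0$, any finite subset $F \subset A$, any $a \in A_+$ with $\|a\| = 1$ and any $b \in A_+$ with $\|b\| \leq 1$, there exist a $C^*$-subalgebra $B \subset A$ with $B \in \Omega$ and an element $r \in B_+$ with $\|r\| \leq 1$ such that (1') $rx \in_{\epsilon} B$ and $xr \in_{\epsilon} B$ for all $x \in F$; (2') $\| rx - xr\| < \epsilon$ for all $x \in F$; (3') $(b^2 - brb -\epsilon)_+ \precsim_A a$; and (4') $\| rar\| \geq 1 - \epsilon$. *)

theory Defs
  imports "HOL-Analysis.Analysis"
begin

class star =
  fixes star :: "'a \<Rightarrow> 'a"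

class scaleC =
  fixes scaleC :: "complex \<Rightarrow> 'a \<Rightarrow> 'a"  (infixr \<open>*\<^sub>C\<close> 75)

text \<open>A C*-algebra, not necessarily unital; the zero algebra is allowed. Submultiplicativity of
  the norm and bilinearity over the reals come from \<^class>\<open>real_normed_algebra\<close>.\<close>

class cstar_algebra = real_normed_algebra + banach + star + scaleC +
  assumes scaleC_add_right: "c *\<^sub>C (x + y) = c *\<^sub>C x + c *\<^sub>C y"
    and scaleC_add_left: "(c + d) *\<^sub>C x = c *\<^sub>C x + d *\<^sub>C x"
    and scaleC_scaleC: "c *\<^sub>C d *\<^sub>C x = (c * d) *\<^sub>C x"
    and scaleR_scaleC: "r *\<^sub>R x = complex_of_real r *\<^sub>C x"
    and norm_scaleC: "norm (c *\<^sub>C x) = cmod c * norm x"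
    and mult_scaleC_left: "(c *\<^sub>C x) * y = c *\<^sub>C (x * y)"
    and mult_scaleC_right: "x * (c *\<^sub>C y) = c *\<^sub>C (x * y)"
    and star_star: "star (star x) = x"
    and star_add: "star (x + y) = star x + star y"
    and star_scaleC: "star (c *\<^sub>C x) = cnj c *\<^sub>C star x"
    and star_mult: "star (x * y) = star y * star x"
    and cstar_identity: "norm (star x * x) = (norm x)\<^sup>2"

text \<open>All C*-algebras under consideration are carried by subsets of one type of class
  \<^class>\<open>cstar_algebra\<close>, with the operations and the norm of that type; an arbitrary C*-algebra
  is obtained as \<^term>\<open>UNIV\<close>. So \<open>B\<close> is a C*-subalgebra of \<open>A\<close> iff \<open>cstar_alg B\<close> and
  \<open>B \<subseteq> A\<close>, and a class of C*-algebras is a set of such subsets (in the definitions below only its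
  members contained in \<open>A\<close> matter). All notions are relative to the carrier: units, spectra and
  ideals of \<open>B\<close> are those of \<open>B\<close> as an algebra in its own right.\<close>

definition csubspace :: "'a::cstar_algebra set \<Rightarrow> bool" where
  "csubspace V \<longleftrightarrow> 0 \<in> V \<and> (\<forall>x\<in>V. \<forall>y\<in>V. x + y \<in> V) \<and> (\<forall>c. \<forall>x\<in>V. c *\<^sub>C x \<in> V)"

definition cstar_alg :: "'a::cstar_algebra set \<Rightarrow> bool" where
  "cstar_alg A \<longleftrightarrow> csubspace A \<and> (\<forall>x\<in>A. \<forall>y\<in>A. x * y \<in> A) \<and> (\<forall>x\<in>A. star x \<in> A) \<and> closed A"

definition is_unit_of :: "'a::cstar_algebra \<Rightarrow> 'a set \<Rightarrow> bool" where
  "is_unit_of e A \<longleftrightarrow> e \<in> A \<and> (\<forall>x\<in>A. e * x = x \<and> x * e = x)"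

definition unital :: "'a::cstar_algebra set \<Rightarrow> bool" where
  "unital A \<longleftrightarrow> (\<exists>e. is_unit_of e A)"

definition unit_of :: "'a::cstar_algebra set \<Rightarrow> 'a" where
  "unit_of A = (THE e. is_unit_of e A)"

definition closed_ideal :: "'a::cstar_algebra set \<Rightarrow> 'a set \<Rightarrow> bool" where
  "closed_ideal I A \<longleftrightarrow>
     I \<subseteq> A \<and> csubspace I \<and> closed I \<and> (\<forall>x\<in>A. \<forall>y\<in>I. x * y \<in> I \<and> y * x \<in> I)"

definition simple :: "'a::cstar_algebra set \<Rightarrow> bool" where
  "simple A \<longleftrightarrow> A \<noteq> {0} \<and> (\<forall>I. closed_ideal I A \<longrightarrow> I = {0} \<or> I = A)"

definition projection :: "'a::cstar_algebra \<Rightarrow> bool" where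
  "projection p \<longleftrightarrow> star p = p \<and> p * p = p"

text \<open>The pair \<open>(c, x)\<close> stands for the element \<open>c1 + x\<close> of the unitization.\<close>

definition unitization_mult ::
    "complex \<times> 'a::cstar_algebra \<Rightarrow> complex \<times> 'a \<Rightarrow> complex \<times> 'a" where
  "unitization_mult u v = (fst u * fst v, fst u *\<^sub>C snd v + fst v *\<^sub>C snd u + snd u * snd v)"

text \<open>The spectrum of an element of a non-unital algebra is its spectrum in the unitization.\<close>

definition spectrum :: "'a::cstar_algebra set \<Rightarrow> 'a \<Rightarrow> complex set" where
  "spectrum A a =
    (if unital A
     then {z. \<not> (\<exists>b\<in>A. b * (z *\<^sub>C unit_of A - a) = unit_of A \<and>
                       (z *\<^sub>C unit_of A - a) * b = unit_of A)}
     else {z. \<not> (\<exists>c. \<exists>b\<in>A. unitization_mult (c, b) (z, - a) = (1, 0) \<and>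
                           unitization_mult (z, - a) (c, b) = (1, 0))})"

definition pos :: "'a::cstar_algebra set \<Rightarrow> 'a set" where
  "pos A = {a \<in> A. star a = a \<and> (\<forall>z\<in>spectrum A a. z \<in> \<real> \<and> 0 \<le> Re z)}"

text \<open>Functions on the spectrum are represented by total functions. On a non-unital algebra the
  calculus is only defined for functions vanishing at 0 (which then belongs to the spectrum).\<close>

definition cfc_dom :: "'a::cstar_algebra set \<Rightarrow> 'a \<Rightarrow> (complex \<Rightarrow> complex) set" where
  "cfc_dom A a = {f. continuous_on (spectrum A a) f \<and> (\<not> unital A \<longrightarrow> f 0 = 0)}"

text \<open>\<open>\<Phi>\<close> is the *-homomorphism from the continuous functions on the spectrum of \<open>a\<close> (vanishing
  at 0 in the non-unital case) to \<open>A\<close> which maps the identity function to \<open>a\<close> and is unital if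
  \<open>A\<close> is. For normal \<open>a\<close> it exists, and it is unique on \<^const>\<open>cfc_dom\<close>; continuity is automatic.\<close>

definition is_cfc :: "'a::cstar_algebra set \<Rightarrow> 'a \<Rightarrow> ((complex \<Rightarrow> complex) \<Rightarrow> 'a) \<Rightarrow> bool" where
  "is_cfc A a \<Phi> \<longleftrightarrow>
     (\<forall>f\<in>cfc_dom A a. \<Phi> f \<in> A) \<and>
     (\<forall>f\<in>cfc_dom A a. \<forall>g\<in>cfc_dom A a. (\<forall>z\<in>spectrum A a. f z = g z) \<longrightarrow> \<Phi> f = \<Phi> g) \<and>
     (\<forall>f\<in>cfc_dom A a. \<forall>g\<in>cfc_dom A a. \<Phi> (\<lambda>z. f z + g z) = \<Phi> f + \<Phi> g) \<and>
     (\<forall>f\<in>cfc_dom A a. \<forall>g\<in>cfc_dom A a. \<Phi> (\<lambda>z. f z * g z) = \<Phi> f * \<Phi> g) \<and>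
     (\<forall>f\<in>cfc_dom A a. \<forall>c. \<Phi> (\<lambda>z. c * f z) = c *\<^sub>C \<Phi> f) \<and>
     (\<forall>f\<in>cfc_dom A a. \<Phi> (\<lambda>z. cnj (f z)) = star (\<Phi> f)) \<and>
     \<Phi> (\<lambda>z. z) = a \<and>
     (unital A \<longrightarrow> \<Phi> (\<lambda>z. 1) = unit_of A)"

definition cfc :: "'a::cstar_algebra set \<Rightarrow> 'a \<Rightarrow> (complex \<Rightarrow> complex) \<Rightarrow> 'a" where
  "cfc A a = (SOME \<Phi>. is_cfc A a \<Phi>)"

text \<open>\<open>pos_cut A a \<epsilon>\<close> is \<open>(a - \<epsilon>)\<^sub>+\<close>, computed in \<open>A\<close>.\<close>

definition pos_cut :: "'a::cstar_algebra set \<Rightarrow> 'a \<Rightarrow> real \<Rightarrow> 'a" where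
  "pos_cut A a \<epsilon> = cfc A a (\<lambda>z. complex_of_real (max (Re z - \<epsilon>) 0))"

definition approx_in :: "'a::cstar_algebra \<Rightarrow> real \<Rightarrow> 'a set \<Rightarrow> bool" where
  "approx_in x \<epsilon> B \<longleftrightarrow> (\<exists>b\<in>B. norm (x - b) < \<epsilon>)"

definition cuntz_le :: "'a::cstar_algebra set \<Rightarrow> 'a \<Rightarrow> 'a \<Rightarrow> bool" where
  "cuntz_le A a b \<longleftrightarrow>
     (\<exists>v :: nat \<Rightarrow> 'a. (\<forall>n. v n \<in> A) \<and> (\<lambda>n. norm (v n * b * star (v n) - a)) \<longlonglongrightarrow> 0)"

definition WTA :: "'a::cstar_algebra set set \<Rightarrow> 'a set set" where
  "WTA \<Omega> = {A. cstar_alg A \<and> simple A \<and> unital A \<and>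
     (\<forall>\<epsilon>>0. \<forall>F a. finite F \<and> F \<subseteq> A \<and> a \<in> pos A \<and> a \<noteq> 0 \<longrightarrow>
       (\<exists>B p g. cstar_alg B \<and> B \<subseteq> A \<and> B \<in> \<Omega> \<and>
          p \<in> A \<and> projection p \<and> is_unit_of p B \<and>
          g \<in> pos B \<and> unit_of A - g \<in> pos A \<and>
          (\<forall>x\<in>F. approx_in ((p - g) * x) \<epsilon> B \<and> approx_in (x * (p - g)) \<epsilon> B) \<and>
          (\<forall>x\<in>F. norm ((p - g) * x - x * (p - g)) < \<epsilon>) \<and>
          cuntz_le A (unit_of A - (p - g)) a \<and>
          norm ((p - g) * a * (p - g)) \<ge> norm a - \<epsilon>))}"

definition GTA :: "'a::cstar_algebra set set \<Rightarrow> 'a set set" where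
  "GTA \<Omega> = {A. cstar_alg A \<and> simple A \<and>
     (\<forall>\<epsilon>>0. \<forall>F a b. finite F \<and> F \<subseteq> A \<and> a \<in> pos A \<and> norm a = 1 \<and> b \<in> pos A \<and> norm b \<le> 1 \<longrightarrow>
       (\<exists>B r. cstar_alg B \<and> B \<subseteq> A \<and> B \<in> \<Omega> \<and>
          r \<in> pos B \<and> norm r \<le> 1 \<and>
          (\<forall>x\<in>F. approx_in (r * x) \<epsilon> B \<and> approx_in (x * r) \<epsilon> B) \<and>
          (\<forall>x\<in>F. norm (r * x - x * r) < \<epsilon>) \<and>
          cuntz_le A (pos_cut A (b * b - b * r * b) \<epsilon>) a \<and>
          norm (r * a * r) \<ge> 1 - \<epsilon>))}"

end

theory Submission
  imports Defs "HOL-Computational_Algebra.Fundamental_Theorem_Algebra"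
begin

text \<open>Passing between the two conditions amounts to \<open>r = p - g\<close>. From WTA to GTA,
  \<open>b\<^sup>2 - brb = b(1 - r)b\<close> is Cuntz below \<open>1 - r\<close>, and cutting down only makes it smaller.
  From GTA to WTA, take \<open>b = 1\<close> and \<open>g = f(r)\<close>, computed in \<open>B\<close>, with
  \<open>f(t) = max (1 - t - \<delta>) 0 / (1 - \<delta>)\<close>: then \<open>p - g\<close> is within \<open>\<delta>\<close> of \<open>r\<close>, and
  \<open>1 - (p - g) = (1 - r - \<delta>)\<^sub>+ / (1 - \<delta>)\<close>.\<close>

section \<open>Spectra of self-adjoint elements\<close>

text \<open>From GTA to WTA the obstacle is that two algebras with different units are involved: the
  cut-down in (3') is computed in \<open>A\<close>, while \<open>g\<close> must be positive in
  \<open>B\<close>, whose unit \<open>p\<close> may differ from the unit \<open>e\<close> of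
  \<open>A\<close>. Since \<open>e - (p - g) = (e - p) + g\<close>, the complement acts as the unit
  on the corner \<open>e - p\<close>, where \<open>r\<close> vanishes, whereas the cut-down of
  \<open>e - r\<close> acts there as \<open>1 - \<delta>\<close>. This forces the division by
  \<open>1 - \<delta>\<close>, harmless because Cuntz comparison ignores positive factors. The same
  invariance allows \<open>a\<close> to be normalized, as GTA speaks only of norm 1. Moreover
  \<open>cfc\<close> is a choice among the maps satisfying \<open>is_cfc\<close>, so nothing can be
  said about a cut-down before such a map is known to exist. This rests on one fact: a self-adjoint
  element has a spectral value whose modulus is its norm. With the C*-identity it bounds the norm of
  a polynomial in the element by the supremum on the spectrum, and Weierstrass approximation then
  leads from polynomials to continuous functions.\<close>

lemma scaleC_one [simp]: "1 *\<^sub>C x = (x::'a::cstar_algebra)"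
  using scaleR_scaleC[of 1 x] by simp

lemma scaleC_zero_left [simp]: "0 *\<^sub>C x = (0::'a::cstar_algebra)"
  using scaleR_scaleC[of 0 x] by simp

lemma scaleC_zero_right [simp]: "c *\<^sub>C 0 = (0::'a::cstar_algebra)"
  using scaleC_add_right[of c "0::'a" 0] by simp

lemma scaleC_minus_left [simp]: "(- c) *\<^sub>C x = - (c *\<^sub>C (x::'a::cstar_algebra))"
  using scaleC_add_left[of "- c" c x] by (simp add: eq_neg_iff_add_eq_0)

lemma scaleC_diff_left: "(c - d) *\<^sub>C x = c *\<^sub>C x - d *\<^sub>C (x::'a::cstar_algebra)"
  using scaleC_add_left[of c "- d" x] by simp

lemma scaleC_diff_right: "c *\<^sub>C (x - y) = c *\<^sub>C x - c *\<^sub>C (y::'a::cstar_algebra)"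
  using scaleC_add_right[of c "x - y" y] by (simp add: algebra_simps)

lemma star_zero [simp]: "star (0::'a::cstar_algebra) = 0"
  using star_add[of "0::'a" 0] by simp

lemma star_minus: "star (- x) = - star (x::'a::cstar_algebra)"
  using star_add[of x "- x"] by (simp add: eq_neg_iff_add_eq_0 add.commute)

lemma star_diff: "star (x - y) = star x - star (y::'a::cstar_algebra)"
  using star_add[of x "- y"] by (simp add: star_minus)

lemma star_scaleR: "star (t *\<^sub>R x) = t *\<^sub>R star (x::'a::cstar_algebra)"
  by (simp add: scaleR_scaleC star_scaleC)

lemma norm_star [simp]: "norm (star x) = norm (x::'a::cstar_algebra)"
proof -
  have *: "norm y \<le> norm (star y)" for y :: 'a
  proof (cases "y = 0")
    case False
    have "norm y * norm y \<le> norm (star y) * norm y"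
      using norm_mult_ineq[of "star y" y] by (simp add: cstar_identity power2_eq_square)
    then show ?thesis using False by simp
  qed simp
  show ?thesis using *[of x] *[of "star x"] by (simp add: star_star)
qed

lemma tendsto_star: "(X \<longlongrightarrow> (x::'a::cstar_algebra)) F \<Longrightarrow> ((\<lambda>n. star (X n)) \<longlongrightarrow> star x) F"
  by (simp add: tendsto_iff dist_norm flip: star_diff)

lemma norm_square_selfadjoint: "star x = x \<Longrightarrow> norm (x * x) = (norm (x::'a::cstar_algebra))\<^sup>2"
  using cstar_identity[of x] by simp

lemma is_unit_of_unique: "is_unit_of d A \<Longrightarrow> is_unit_of e A \<Longrightarrow> d = e"
  unfolding is_unit_of_def by metis

section \<open>Invertibility and spectra relative to a carrier with unit\<close>

definition inverses :: "'a::cstar_algebra set \<Rightarrow> 'a \<Rightarrow> 'a \<Rightarrow> 'a \<Rightarrow> bool" where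
  "inverses A e x y \<longleftrightarrow> x \<in> A \<and> y \<in> A \<and> x * y = e \<and> y * x = e"

text \<open>The unit is a parameter, so that \<open>A\<close> and a subalgebra \<open>B\<close> can
  be instances with different units. The zero algebra, \<open>e = 0\<close>, is allowed; hence
  \<open>norm_unit_le\<close> is only an inequality and some later proofs split on
  \<open>e = 0\<close>.\<close>

locale unital_cstar =
  fixes A :: "'a::cstar_algebra set" and e :: 'a
  assumes cstar_alg: "cstar_alg A" and unit: "is_unit_of e A"
begin

lemma zero_mem [intro, simp]: "0 \<in> A"
  and add_mem [intro, simp]: "x \<in> A \<Longrightarrow> y \<in> A \<Longrightarrow> x + y \<in> A"
  and scaleC_mem [intro, simp]: "x \<in> A \<Longrightarrow> c *\<^sub>C x \<in> A"
  and mult_mem [intro, simp]: "x \<in> A \<Longrightarrow> y \<in> A \<Longrightarrow> x * y \<in> A"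
  and star_mem [intro, simp]: "x \<in> A \<Longrightarrow> star x \<in> A"
  and closed: "closed A"
  using cstar_alg by (auto simp: cstar_alg_def csubspace_def)

lemma scaleR_mem [intro, simp]: "x \<in> A \<Longrightarrow> t *\<^sub>R x \<in> A"
  by (simp add: scaleR_scaleC)

lemma minus_mem [intro, simp]: "x \<in> A \<Longrightarrow> - x \<in> A"
  using scaleR_mem[of x "-1"] by simp

lemma diff_mem [intro, simp]: "x \<in> A \<Longrightarrow> y \<in> A \<Longrightarrow> x - y \<in> A"
  using add_mem[of x "- y"] by simp

lemma unit_mem [intro, simp]: "e \<in> A"
  and unit_left [simp]: "x \<in> A \<Longrightarrow> e * x = x"
  and unit_right [simp]: "x \<in> A \<Longrightarrow> x * e = x"
  using unit by (auto simp: is_unit_of_def)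

lemma unital [simp]: "unital A"
  using unit by (auto simp: unital_def)

lemma unit_of_eq [simp]: "unit_of A = e"
  unfolding unit_of_def using unit is_unit_of_unique by blast

lemma star_unit [simp]: "star e = e"
  by (metis star_mem star_mult star_star unit_left unit_mem)

lemma norm_unit_le: "norm e \<le> 1"
proof (cases "e = 0")
  case False
  have "norm e * norm e = norm e * 1"
    using cstar_identity[of e] by (simp add: power2_eq_square)
  then show ?thesis using False by simp
qed simp

lemma eq_zero_of_unit_zero: "e = 0 \<Longrightarrow> x \<in> A \<Longrightarrow> x = 0"
  using unit_left[of x] by simp

lemma spectrum_iff:
  "x \<in> A \<Longrightarrow> z \<in> spectrum A x \<longleftrightarrow> \<not> (\<exists>y. inverses A e (z *\<^sub>C e - x) y)"
  by (auto simp: spectrum_def inverses_def)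

text \<open>Instead of summing the Neumann series, the one-sided inverses are found as fixed points:
  \<open>y \<mapsto> e + x * y\<close> and \<open>y \<mapsto> e + y * x\<close> are contractions of
  \<open>A\<close> with constant \<open>norm x\<close>. Associativity identifies the two.\<close>

lemma inverses_unit_diff:
  assumes x: "x \<in> A" and nx: "norm x < 1"
  shows "\<exists>y. inverses A e (e - x) y"
proof -
  have "\<exists>!y. y \<in> A \<and> e + x * y = y"
  proof (rule Banach_fix[of _ "norm x", simplified])
    show "complete A" using closed by (simp add: complete_eq_closed)
    show "A \<noteq> {}" using zero_mem by blast
    show "dist (e + x * y) (e + x * y') \<le> norm x * dist y y'" for y y'
      using norm_mult_ineq[of x "y - y'"] by (simp add: dist_norm algebra_simps)
  qed (use x nx in auto)
  then obtain u where u: "u \<in> A" "e + x * u = u" by blast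
  have "\<exists>!y. y \<in> A \<and> e + y * x = y"
  proof (rule Banach_fix[of _ "norm x", simplified])
    show "complete A" using closed by (simp add: complete_eq_closed)
    show "A \<noteq> {}" using zero_mem by blast
    show "dist (e + y * x) (e + y' * x) \<le> norm x * dist y y'" for y y'
      using norm_mult_ineq[of "y - y'" x] by (simp add: dist_norm algebra_simps)
  qed (use x nx in auto)
  then obtain v where v: "v \<in> A" "e + v * x = v" by blast
  have 1: "(e - x) * u = e" "v * (e - x) = e"
    using u v by (simp_all add: algebra_simps)
  have "v = v * ((e - x) * u)" using 1 v by simp
  also have "\<dots> = u" using 1 u x by (subst mult.assoc[symmetric]) simp
  finally show ?thesis using 1 u x by (auto simp: inverses_def)
qed

lemma inverses_mult:
  "inverses A e x y \<Longrightarrow> inverses A e x' y' \<Longrightarrow> inverses A e (x * x') (y' * y)"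
  unfolding inverses_def
  by (smt (verit) mult.assoc mult_mem unit_left)

lemma inverses_scaleC:
  "inverses A e x y \<Longrightarrow> c \<noteq> 0 \<Longrightarrow> inverses A e (c *\<^sub>C x) (inverse c *\<^sub>C y)"
  unfolding inverses_def
  by (auto simp: mult_scaleC_left mult_scaleC_right scaleC_scaleC)

lemma norm_le_of_mem_spectrum:
  assumes x: "x \<in> A" and z: "z \<in> spectrum A x"
  shows "cmod z \<le> norm x"
proof (rule ccontr)
  assume *: "\<not> cmod z \<le> norm x"
  then have z0: "z \<noteq> 0" by auto
  have "norm (inverse z *\<^sub>C x) < 1"
    using * z0 by (simp add: norm_scaleC norm_inverse) (simp add: field_simps)
  then obtain y where "inverses A e (e - inverse z *\<^sub>C x) y"
    using inverses_unit_diff x by blast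
  from inverses_scaleC[OF this z0] have "inverses A e (z *\<^sub>C e - x) (inverse z *\<^sub>C y)"
    using z0 by (simp add: scaleC_diff_right scaleC_scaleC)
  then show False using z x spectrum_iff by blast
qed

text \<open>Adding the multiple \<open>\<i> * t\<close> of the unit, with \<open>t\<close> real,
  raises the squared norm of \<open>h\<close> by at most \<open>t\<^sup>2\<close>, but the squared
  modulus of the spectral value \<open>z\<close> by \<open>t\<^sup>2 + 2 * Im z * t\<close>. A
  suitable \<open>t\<close> makes the linear term too large.\<close>

lemma spectrum_selfadjoint_real:
  assumes h: "h \<in> A" "star h = h" and z: "z \<in> spectrum A h"
  shows "Im z = 0"
proof (rule ccontr)
  assume *: "Im z \<noteq> 0"
  \<comment> \<open>Chosen so that \<open>2 * Im z * t\<close> exceeds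
    \<open>(norm h)\<^sup>2\<close> by 1, whatever the sign of \<open>Im z\<close>.\<close>
  define t where "t = ((norm h)\<^sup>2 + 1) / (2 * Im z)"
  define w where "w = \<i> * complex_of_real t"
  define k where "k = h + w *\<^sub>C e"
  have kA: "k \<in> A" using h by (simp add: k_def)
  have "z + w \<in> spectrum A k"
    using z h by (simp add: spectrum_iff k_def scaleC_add_left)
  then have 1: "cmod (z + w) \<le> norm k" using norm_le_of_mem_spectrum kA by blast
  have sk: "star k = h - w *\<^sub>C e"
    by (simp add: k_def star_add star_scaleC h w_def)
  have ww: "w * w = - complex_of_real (t\<^sup>2)"
    by (simp add: w_def power2_eq_square algebra_simps)
  have "star k * k = h * h + (t\<^sup>2) *\<^sub>R e"
    unfolding sk unfolding k_def scaleR_scaleC using h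
    by (simp add: left_diff_distrib distrib_left mult_scaleC_left mult_scaleC_right scaleC_diff_right scaleC_scaleC ww)
  then have "(norm k)\<^sup>2 \<le> (norm h)\<^sup>2 + t\<^sup>2 * norm e"
    using norm_triangle_ineq[of "h * h" "(t\<^sup>2) *\<^sub>R e"] h
      cstar_identity[of k] norm_square_selfadjoint[of h] by simp
  also have "\<dots> \<le> (norm h)\<^sup>2 + t\<^sup>2"
    using norm_unit_le mult_left_mono[of "norm e" 1 "t\<^sup>2"] by simp
  finally have "(cmod (z + w))\<^sup>2 \<le> (norm h)\<^sup>2 + t\<^sup>2"
    using 1 by (meson norm_ge_zero order_trans power_mono)
  then have "(Re z)\<^sup>2 + (Im z)\<^sup>2 + 2 * Im z * t \<le> (norm h)\<^sup>2"
    by (simp add: cmod_power2 w_def) (simp add: power2_eq_square algebra_simps)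
  moreover have "2 * Im z * t = (norm h)\<^sup>2 + 1"
    using * by (simp add: t_def)
  ultimately show False by (smt (verit) zero_le_power2)
qed

text \<open>The partial fraction 2/(1 - x^2) = 1/(1 - x) + 1/(1 + x). It is the averaging step that
  doubles the exponent in the spectral radius argument.\<close>

lemma inverses_diff_square:
  assumes x: "x \<in> A" and u: "inverses A e (e - x) u" and v: "inverses A e (e + x) v"
  shows "inverses A e (e - x * x) ((1/2) *\<^sub>R (u + v))"
proof -
  have *: "e - x * x = (e + x) * (e - x)" "e - x * x = (e - x) * (e + x)"
    using x by (simp_all add: algebra_simps)
  have uv: "u \<in> A" "v \<in> A" using u v by (auto simp: inverses_def)
  have "(e - x * x) * u = e + x" "u * (e - x * x) = e + x"
    using u x unfolding inverses_def
    by (metis * add_mem mult.assoc unit_mem unit_right, metis * add_mem mult.assoc unit_mem unit_left)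
  moreover have "(e - x * x) * v = e - x" "v * (e - x * x) = e - x"
    using v x unfolding inverses_def
    by (metis * diff_mem mult.assoc unit_mem unit_right, metis * diff_mem mult.assoc unit_mem unit_left)
  ultimately have "(e - x * x) * (u + v) = 2 *\<^sub>R e" "(u + v) * (e - x * x) = 2 *\<^sub>R e"
    by (simp_all add: distrib_left distrib_right scaleR_2)
  then show ?thesis using x uv by (simp add: inverses_def)
qed

text \<open>If no spectral value of \<open>h\<close> attains the norm, then \<open>G z = (1 - zb)\<^sup>-\<^sup>1\<close> is uniformly continuous
  on the closed unit disc, where \<open>b = h / \<parallel>h\<parallel>\<close>. Averaging over the \<open>2^k\<close>-th roots of unity turns
  \<open>G\<close> into \<open>z \<mapsto> (1 - (zb)^2^k)\<^sup>-\<^sup>1\<close> without increasing the oscillation, so comparing \<open>z = 1\<close> with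
  some \<open>z = r < 1\<close> shows \<open>b^2^k \<rightarrow> 0\<close>. But all these powers have norm 1.\<close>

lemma spectral_radius_selfadjoint:
  assumes h: "h \<in> A" "star h = h" and e0: "e \<noteq> 0"
  shows "\<exists>z\<in>spectrum A h. cmod z = norm h"
proof (cases "h = 0")
  case True
  have "0 \<in> spectrum A h" using e0 by (simp add: True spectrum_iff inverses_def)
  then show ?thesis using True by auto
next
  case False
  show ?thesis
  proof (rule ccontr)
    assume no: "\<not> ?thesis"
    define M where "M = norm h"
    have M: "M > 0" using False by (simp add: M_def)
    define b where "b = (1/M) *\<^sub>R h"
    have b: "b \<in> A" "star b = b" "norm b = 1"
      using h M by (simp_all add: b_def star_scaleR M_def)
    have "\<exists>y. inverses A e (e - z *\<^sub>C b) y" if z: "cmod z \<le> 1" for z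
    proof (cases "z = 0")
      case True
      then show ?thesis by (intro exI[of _ e]) (simp add: inverses_def)
    next
      case z0: False
      \<comment> \<open>Its modulus is at least \<open>M\<close>. A larger modulus is kept out of
        the spectrum by the norm bound, modulus exactly \<open>M\<close> by the assumption
        \<open>no\<close>.\<close>
      define w where "w = complex_of_real M / z"
      have w0: "w \<noteq> 0" using z0 M by (simp add: w_def)
      have "cmod w * cmod z = M" using z0 M by (simp add: w_def norm_divide)
      then have "M \<le> cmod w" using z mult_left_mono[of "cmod z" 1 "cmod w"] by simp
      then have "w \<notin> spectrum A h"
        using no norm_le_of_mem_spectrum[of h w] h unfolding M_def by force
      then obtain y where "inverses A e (w *\<^sub>C e - h) y" using h spectrum_iff by blast
      from inverses_scaleC[OF this, of "inverse w"]
      have "inverses A e (inverse w *\<^sub>C (w *\<^sub>C e - h)) (w *\<^sub>C y)" using w0 by simp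
      moreover have "inverse w *\<^sub>C (w *\<^sub>C e - h) = e - z *\<^sub>C b"
        using w0 M z0 by (simp add: scaleC_diff_right scaleC_scaleC b_def scaleR_scaleC)
          (simp add: w_def)
      ultimately show ?thesis by metis
    qed
    then obtain G where G: "\<And>z. cmod z \<le> 1 \<Longrightarrow> inverses A e (e - z *\<^sub>C b) (G z)" by metis
    \<comment> \<open>The resolvent identity
      \<open>G z - G w = G z * ((z - w) *\<^sub>C b) * G w\<close>, combined with
      \<open>norm b = 1\<close>.\<close>
    have resolvent: "norm (G z - G w) \<le> cmod (z - w) * norm (G z) * norm (G w)"
      if "cmod z \<le> 1" "cmod w \<le> 1" for z w
    proof -
      note G' = G[OF that(1), unfolded inverses_def] G[OF that(2), unfolded inverses_def]
      have "G z * (e - w *\<^sub>C b) * G w = G z" using G' by (simp add: mult.assoc)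
      moreover have "G z * (e - z *\<^sub>C b) * G w = G w" using G' by simp
      ultimately have "G z - G w = G z * ((e - w *\<^sub>C b) - (e - z *\<^sub>C b)) * G w"
        by (simp only: right_diff_distrib left_diff_distrib)
      also have "(e - w *\<^sub>C b) - (e - z *\<^sub>C b) = (z - w) *\<^sub>C b"
        by (simp add: scaleC_diff_left)
      finally have "norm (G z - G w) \<le> norm (G z * ((z - w) *\<^sub>C b)) * norm (G w)"
        by (simp add: norm_mult_ineq)
      also have "\<dots> \<le> (norm (G z) * norm ((z - w) *\<^sub>C b)) * norm (G w)"
        by (intro mult_right_mono norm_mult_ineq) simp
      finally show ?thesis by (simp add: norm_scaleC b mult_ac)
    qed
    have "continuous_on (cball 0 1) G"
    proof (rule continuous_on_iff[THEN iffD2], intro ballI allI impI)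
      fix z :: complex and \<epsilon> :: real assume z: "z \<in> cball 0 1" and \<epsilon>: "\<epsilon> > 0"
      define K where "K = norm (G z) + 1"
      have K: "K > 0" "norm (G z) \<le> K" by (auto simp: K_def intro: add_nonneg_pos)
      \<comment> \<open>The first bound gives \<open>cmod (z - w) * norm (G z) \<le> 1/2\<close>,
        hence \<open>norm (G w) \<le> 2 * K\<close>; the second then makes the resolvent estimate
        smaller than \<open>\<epsilon>\<close>.\<close>
      define d where "d = min (1 / (2 * K)) (\<epsilon> / (2 * K * K))"
      have d: "d > 0" using K \<epsilon> by (simp add: d_def)
      have "dist (G w) (G z) < \<epsilon>" if w: "w \<in> cball 0 1" and dw: "dist w z < d" for w
      proof -
        have zw: "cmod (z - w) < d" using dw by (simp add: dist_norm norm_minus_commute)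
        have zK: "cmod (z - w) * norm (G z) \<le> 1 / 2"
        proof -
          have "cmod (z - w) * norm (G z) \<le> (1 / (2 * K)) * K"
            using zw K by (intro mult_mono) (auto simp: d_def)
          then show ?thesis using K by simp
        qed
        have r: "norm (G z - G w) \<le> cmod (z - w) * norm (G z) * norm (G w)"
          using resolvent z w by simp
        also have "\<dots> \<le> 1 / 2 * norm (G w)"
          using zK by (intro mult_right_mono) auto
        finally have "norm (G w) \<le> 2 * norm (G z)"
          using norm_triangle_sub[of "G w" "G z"] by (simp add: norm_minus_commute)
        then have gw: "norm (G w) \<le> 2 * K" using K by simp
        have "norm (G z - G w) \<le> cmod (z - w) * K * (2 * K)"
          by (rule order_trans[OF r]) (use gw K in \<open>intro mult_mono; auto\<close>)
        also have "\<dots> < d * K * (2 * K)" using zw K by simp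
        also have "\<dots> \<le> \<epsilon> / (2 * K * K) * K * (2 * K)"
          using K by (intro mult_right_mono) (auto simp: d_def)
        also have "\<dots> = \<epsilon>" using K by simp
        finally show ?thesis by (simp add: dist_norm norm_minus_commute)
      qed
      then show "\<exists>d>0. \<forall>w\<in>cball 0 1. dist w z < d \<longrightarrow> dist (G w) (G z) < \<epsilon>" using d by blast
    qed
    then have "uniformly_continuous_on (cball 0 1) G"
      by (rule compact_uniformly_continuous) simp
    then obtain d where d: "d > 0"
      "\<And>z w. z \<in> cball 0 1 \<Longrightarrow> w \<in> cball 0 1 \<Longrightarrow> dist w z < d \<Longrightarrow> dist (G w) (G z) < 1/8"
      unfolding uniformly_continuous_on_def by (metis zero_less_divide_1_iff zero_less_numeral)
    \<comment> \<open>\<open>1 - d/2\<close> keeps \<open>r * z\<close> within \<open>d\<close> of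
      \<open>z\<close> on the unit disc; \<open>1/2\<close> keeps \<open>r\<close> positive when
      \<open>d\<close> is large.\<close>
    define r where "r = max (1 - d/2) (1/2)"
    have r: "0 < r" "r < 1" "1 - r < d" using d by (auto simp: r_def)
    define c where "c k = ((\<lambda>x. x * x) ^^ k) b" for k
    have c: "c k \<in> A \<and> star (c k) = c k \<and> norm (c k) = 1" for k
      by (induction k) (simp_all add: c_def b star_mult norm_square_selfadjoint)
    \<comment> \<open>\<open>H\<close> is \<open>G\<close> for \<open>k = 0\<close> and is averaged
      over two rotated copies at each step. Scaling by \<open>r\<close> commutes with rotation, so
      the bound 1/8 survives every average.\<close>
    have "\<exists>H. \<forall>z. cmod z \<le> 1 \<longrightarrow>
        inverses A e (e - z ^ (2 ^ k) *\<^sub>C c k) (H z) \<and> norm (H z - H (of_real r * z)) \<le> 1/8" for k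
    proof (induction k)
      case 0
      have "norm (G z - G (of_real r * z)) \<le> 1/8" if z: "cmod z \<le> 1" for z
      proof -
        have "of_real r * z - z = of_real (r - 1) * z" by (simp add: algebra_simps)
        then have "dist (of_real r * z) z = (1 - r) * cmod z"
          using r by (simp add: dist_norm norm_mult del: of_real_diff)
        also have "\<dots> \<le> (1 - r) * 1"
          using z r by (intro mult_left_mono) auto
        also have "\<dots> < d" using r by simp
        finally have "dist (of_real r * z) z < d" .
        moreover have "cmod (of_real r * z) \<le> 1"
          using z r by (simp add: norm_mult mult_le_one)
        ultimately show ?thesis using d(2)[of z "of_real r * z"] z
          by (simp add: dist_norm norm_minus_commute less_imp_le)
      qed
      then show ?case using G by (intro exI[of _ G]) (auto simp: c_def)
    next
      case (Suc k)
      then obtain H where H: "\<And>z. cmod z \<le> 1 \<Longrightarrow> inverses A e (e - z ^ (2 ^ k) *\<^sub>C c k) (H z)"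
        "\<And>z. cmod z \<le> 1 \<Longrightarrow> norm (H z - H (of_real r * z)) \<le> 1/8" by blast
      \<comment> \<open>A primitive \<open>2 ^ Suc k\<close>-th root of unity: passing from
        \<open>z\<close> to \<open>\<omega> * z\<close> changes the sign of
        \<open>z ^ (2 ^ k)\<close>, so \<open>e - x\<close> becomes \<open>e + x\<close>.\<close>
      define \<omega> where "\<omega> = cis (pi / 2 ^ k)"
      have "\<omega> ^ (2 ^ k) = -1"
        unfolding \<omega>_def by (subst Complex.DeMoivre) simp
      then have \<omega>: "cmod \<omega> = 1" "\<omega> ^ (2 ^ k) = -1" by (simp_all add: \<omega>_def)
      define H' where "H' z = (1/2) *\<^sub>R (H z + H (\<omega> * z))" for z
      have "inverses A e (e - z ^ (2 ^ Suc k) *\<^sub>C c (Suc k)) (H' z)"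
        if z: "cmod z \<le> 1" for z
      proof -
        define x where "x = z ^ (2 ^ k) *\<^sub>C c k"
        have "inverses A e (e - x) (H z)" using H(1)[OF z] by (simp add: x_def)
        moreover have "inverses A e (e + x) (H (\<omega> * z))"
          using H(1)[of "\<omega> * z"] z \<omega> by (simp add: x_def norm_mult power_mult_distrib)
        ultimately have "inverses A e (e - x * x) (H' z)"
          unfolding H'_def using c by (intro inverses_diff_square) (auto simp: x_def)
        moreover have "x * x = z ^ (2 ^ Suc k) *\<^sub>C c (Suc k)"
          by (simp add: x_def c_def mult_scaleC_left mult_scaleC_right scaleC_scaleC mult_2 flip: power_add)
        ultimately show ?thesis by simp
      qed
      moreover have "norm (H' z - H' (of_real r * z)) \<le> 1/8" if z: "cmod z \<le> 1" for z
      proof -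
        have "H' z - H' (of_real r * z) =
          (1/2) *\<^sub>R ((H z - H (of_real r * z)) + (H (\<omega> * z) - H (of_real r * (\<omega> * z))))"
          by (simp add: H'_def algebra_simps)
        also have "norm \<dots> \<le> (1/2) * (1/8 + 1/8)"
          using norm_triangle_ineq[of "H z - H (of_real r * z)" "H (\<omega> * z) - H (of_real r * (\<omega> * z))"]
            H(2)[OF z] H(2)[of "\<omega> * z"] z \<omega> by (simp add: norm_mult)
        finally show ?thesis by simp
      qed
      ultimately show ?case by blast
    qed
    moreover obtain n where n: "r ^ n < 1/16"
      using real_arch_pow_inv[of "1/16" r] r by auto
    ultimately obtain H where H: "\<And>z. cmod z \<le> 1 \<Longrightarrow>
        inverses A e (e - z ^ (2 ^ n) *\<^sub>C c n) (H z) \<and> norm (H z - H (of_real r * z)) \<le> 1/8" by metis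
    define s where "s = r ^ (2 ^ n)"
    have "s \<le> r ^ n"
      unfolding s_def using r by (intro power_decreasing) (auto simp: less_imp_le)
    then have "s < 1/16" using n by (rule order_le_less_trans)
    moreover have "0 < s" using r by (simp add: s_def)
    ultimately have s: "0 < s" "s < 1/16" by auto
    define u v where "u = H 1" and "v = H (of_real r)"
    have u: "inverses A e (e - c n) u" and uv: "norm (u - v) \<le> 1/8"
      using H[of 1] by (simp_all add: u_def v_def)
    have v: "inverses A e (e - s *\<^sub>R c n) v"
      using H[of "of_real r"] r by (simp add: v_def s_def scaleR_scaleC)
    have "v - e = s *\<^sub>R (v * c n)"
    proof -
      have "v * (e - s *\<^sub>R c n) = e" "v \<in> A" using v by (auto simp: inverses_def)
      then show ?thesis by (simp add: right_diff_distrib) (simp add: algebra_simps)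
    qed
    then have ve: "norm (v - e) \<le> s * norm v"
      using norm_mult_ineq[of v "c n"] c[of n] s by simp
    also have "\<dots> \<le> (1/16) * norm v" using s by (intro mult_right_mono) auto
    finally have "norm (v - e) \<le> 1/8"
      using norm_triangle_sub[of v e] norm_unit_le by linarith
    then have ue: "norm (u - e) \<le> 1/4"
      using uv norm_triangle_ineq[of "u - v" "v - e"] by simp
    \<comment> \<open>\<open>u\<close> inverts \<open>e - c n\<close>. Being within 1/4 of
      \<open>e\<close>, it forces \<open>norm (c n) \<le> 1/2\<close>, against
      \<open>norm (c n) = 1\<close>.\<close>
    have "c n = (u - e) * (e - c n)"
      using u c[of n] by (simp add: inverses_def left_diff_distrib)
    then have "norm (c n) \<le> norm (u - e) * norm (e - c n)"
      by (metis norm_mult_ineq)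
    also have "\<dots> \<le> (1/4) * 2"
      using ue norm_triangle_ineq4[of e "c n"] norm_unit_le c[of n]
      by (intro mult_mono) auto
    finally show False using c[of n] by simp
  qed
qed

end

section \<open>Continuous functional calculus\<close>

context unital_cstar
begin

text \<open>\<open>x - w = x * (e - y * w)\<close>, and the second factor is invertible because
  \<open>norm (y * w) < 1\<close>.\<close>

lemma inverses_perturb:
  assumes x: "inverses A e x y" and w: "w \<in> A" "norm w * norm y < 1"
  shows "\<exists>y'. inverses A e (x - w) y'"
proof -
  have y: "y \<in> A" "x \<in> A" "x * y = e" using x by (auto simp: inverses_def)
  have "norm (y * w) < 1"
    using norm_mult_ineq[of y w] w by (simp add: mult.commute)
  then obtain v where "inverses A e (e - y * w) v"
    using inverses_unit_diff y w by blast
  from inverses_mult[OF x this] show ?thesis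
    using y w by (auto simp: right_diff_distrib simp flip: mult.assoc)
qed

lemma compact_spectrum:
  assumes x: "x \<in> A"
  shows "compact (spectrum A x)"
proof -
  have "open (- spectrum A x)"
    unfolding open_dist
  proof
    fix z assume "z \<in> - spectrum A x"
    then obtain y where y: "inverses A e (z *\<^sub>C e - x) y" using spectrum_iff x by auto
    have "w \<in> - spectrum A x" if w: "dist w z < 1 / (norm y + 1)" for w
    proof -
      have "norm ((z - w) *\<^sub>C e) \<le> dist w z * 1"
        unfolding norm_scaleC dist_norm
        using norm_unit_le by (intro mult_mono) (simp_all add: norm_minus_commute)
      then have "norm ((z - w) *\<^sub>C e) * norm y \<le> dist w z * norm y"
        by (simp add: mult_right_mono)
      also have "\<dots> \<le> 1 / (norm y + 1) * norm y"
        using w by (intro mult_right_mono) auto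
      also have "\<dots> < 1"
        by (simp add: divide_less_eq_1 add_nonneg_pos)
      finally have "\<exists>y'. inverses A e (z *\<^sub>C e - x - (z - w) *\<^sub>C e) y'"
        using inverses_perturb y by blast
      moreover have "z *\<^sub>C e - x - (z - w) *\<^sub>C e = w *\<^sub>C e - x"
        by (simp add: scaleC_diff_left)
      ultimately show ?thesis using x spectrum_iff by auto
    qed
    moreover have "1 / (norm y + 1) > 0" by (simp add: add_nonneg_pos)
    ultimately show "\<exists>\<epsilon>>0. \<forall>w. dist w z < \<epsilon> \<longrightarrow> w \<in> - spectrum A x" by blast
  qed
  moreover have "bounded (spectrum A x)"
    using norm_le_of_mem_spectrum[OF x] by (auto simp: bounded_iff)
  ultimately show ?thesis by (simp add: compact_eq_bounded_closed closed_open)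
qed

text \<open>Horner's scheme. The type has no unit of its own, so constant terms become multiples of
  \<open>e\<close>, and the value depends on the algebra in which it is computed.\<close>

definition peval :: "'a \<Rightarrow> complex poly \<Rightarrow> 'a" where
  "peval a p = fold_coeffs (\<lambda>c x. c *\<^sub>C e + a * x) p 0"

lemma peval_0 [simp]: "peval a 0 = 0"
  by (simp add: peval_def)

lemma peval_pCons [simp]: "peval a (pCons c p) = c *\<^sub>C e + a * peval a p"
  by (cases "c = 0 \<and> p = 0") (auto simp: peval_def)

lemma peval_mem [simp]: "a \<in> A \<Longrightarrow> peval a p \<in> A"
  by (induction p) auto

lemma peval_add: "peval a (p + q) = peval a p + peval a q"
proof (induction p arbitrary: q)
  case (pCons c p)
  then show ?case by (cases q) (simp add: scaleC_add_left algebra_simps)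
qed simp

lemma peval_smult: "a \<in> A \<Longrightarrow> peval a (smult c p) = c *\<^sub>C peval a p"
  by (induction p) (simp_all add: scaleC_add_right scaleC_scaleC mult_scaleC_right)

lemma peval_mult: "a \<in> A \<Longrightarrow> peval a (p * q) = peval a p * peval a q"
  by (induction p) (simp_all add: mult_pCons_left peval_add peval_smult algebra_simps mult_scaleC_left)

lemma peval_diff: "a \<in> A \<Longrightarrow> peval a (p - q) = peval a p - peval a q"
  using peval_add[of a p "smult (-1) q"] peval_smult[of a "-1" q] by simp

lemma peval_commute: "a \<in> A \<Longrightarrow> peval a p * a = a * peval a p"
  using peval_mult[of a p "[:0, 1:]"] peval_mult[of a "[:0, 1:]" p] by (simp add: mult.commute)

lemma star_peval:
  assumes "a \<in> A" "star a = a"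
  shows "star (peval a p) = peval a (map_poly cnj p)"
  by (induction p)
    (simp_all add: map_poly_pCons star_add star_scaleC star_mult assms peval_commute)

text \<open>Over the complex numbers \<open>p\<close> splits into linear factors. Every root lies
  outside the spectrum, so every factor is invertible; they are split off one at a time.\<close>

lemma inverses_peval:
  assumes a: "a \<in> A" and "p \<noteq> 0" "\<And>z. z \<in> spectrum A a \<Longrightarrow> poly p z \<noteq> 0"
  shows "\<exists>y. inverses A e (peval a p) y"
  using assms(2,3)
proof (induction "degree p" arbitrary: p)
  case 0
  then obtain c where "p = [:c:]" "c \<noteq> 0" by (metis degree_eq_zeroE pCons_0_0)
  moreover have "inverses A e e e" by (simp add: inverses_def)
  ultimately show ?case using inverses_scaleC[of e e c] by auto
next
  case (Suc n)
  have "\<not> constant (poly p)" using Suc.hyps(2) by (simp add: constant_degree)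
  then obtain w where w: "poly p w = 0" using fundamental_theorem_of_algebra by blast
  then obtain q where q: "p = [:- w, 1:] * q" by (metis poly_eq_0_iff_dvd dvdE)
  have q0: "q \<noteq> 0" using q Suc.prems(1) by auto
  have "degree p = Suc (degree q)"
    unfolding q using q0 by (subst degree_mult_eq) auto
  then have "n = degree q" using Suc.hyps(2) by simp
  moreover have "poly q z \<noteq> 0" if "z \<in> spectrum A a" for z
    using Suc.prems(2)[OF that] by (auto simp: q)
  ultimately obtain y where y: "inverses A e (peval a q) y" using Suc.hyps(1) q0 by metis
  have "w \<notin> spectrum A a" using Suc.prems(2) w by blast
  then obtain v where "inverses A e (w *\<^sub>C e - a) v" using spectrum_iff a by blast
  from inverses_scaleC[OF this, of "-1"]
  have "inverses A e (a - w *\<^sub>C e) (- v)" by (simp add: scaleC_minus_left)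
  from inverses_mult[OF this y] show ?case
    using a by (auto simp: q peval_mult simp del: mult_pCons_left)
qed

text \<open>By the C*-identity the squared norm is the norm of the self-adjoint
  \<open>peval a q\<close>, which has a spectral value of that modulus. By
  \<open>inverses_peval\<close> this value is attained by \<open>q\<close> on the spectrum of
  \<open>a\<close>; as that spectrum is real, \<open>q\<close> is there the squared modulus of
  \<open>p\<close>.\<close>

lemma norm_peval_le:
  assumes a: "a \<in> A" "star a = a" and M: "0 \<le> M" "\<And>z. z \<in> spectrum A a \<Longrightarrow> cmod (poly p z) \<le> M"
  shows "norm (peval a p) \<le> M"
proof (cases "e = 0")
  case True
  show ?thesis using eq_zero_of_unit_zero[OF True peval_mem[OF a(1)]] M by simp
next
  case False
  define q where "q = map_poly cnj p * p"
  have q: "peval a q = star (peval a p) * peval a p"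
    using a by (simp add: q_def peval_mult star_peval)
  have "star (peval a q) = peval a q" by (simp add: q star_mult star_star)
  then obtain \<mu> where \<mu>: "\<mu> \<in> spectrum A (peval a q)" "cmod \<mu> = (norm (peval a p))\<^sup>2"
    using spectral_radius_selfadjoint[of "peval a q"] a False by (auto simp: q cstar_identity)
  have "\<exists>w\<in>spectrum A a. poly q w = \<mu>"
  proof (rule ccontr)
    assume no: "\<not> ?thesis"
    \<comment> \<open>The spectrum is nonempty, so \<open>[:\<mu>:] - q\<close>, which has no root
      there, is not the zero polynomial.\<close>
    obtain w where w: "w \<in> spectrum A a"
      using spectral_radius_selfadjoint[OF a False] by blast
    have "poly ([:\<mu>:] - q) z \<noteq> 0" if "z \<in> spectrum A a" for z
      using no that by auto
    moreover from this[OF w] have "[:\<mu>:] - q \<noteq> 0" by (metis poly_0)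
    ultimately obtain y where "inverses A e (peval a ([:\<mu>:] - q)) y"
      using inverses_peval a by blast
    then show False using \<mu> a by (auto simp: spectrum_iff peval_diff)
  qed
  then obtain w where w: "w \<in> spectrum A a" "poly q w = \<mu>" by blast
  have "cnj w = w"
    using spectrum_selfadjoint_real[OF a w(1)] by (simp add: complex_eq_iff)
  then have "poly (map_poly cnj p) w = cnj (poly p w)"
    using poly_cnj[of p w] by metis
  then have "\<mu> = cnj (poly p w) * poly p w"
    unfolding w(2)[symmetric] q_def poly_mult by (rule arg_cong)
  then have "cmod \<mu> = (cmod (poly p w))\<^sup>2"
    by (simp add: norm_mult power2_eq_square)
  then have "norm (peval a p) = cmod (poly p w)"
    using \<mu> by (metis norm_ge_zero power2_eq_imp_eq)
  then show ?thesis using M w by simp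
qed

end

section \<open>Weierstrass approximation on a compact set of real numbers\<close>

lemma real_polynomial_function_complex_poly:
  "real_polynomial_function g \<Longrightarrow>
    \<exists>p. \<forall>t::real. poly p (complex_of_real t) = complex_of_real (g t)"
proof (induction rule: real_polynomial_function.induct)
  case (linear f)
  have "poly [:0, complex_of_real (f 1):] (complex_of_real t) = complex_of_real (f t)" for t
    using linear_simps(5)[OF linear, of t 1] by simp
  then show ?case by blast
next
  case (const c)
  then show ?case by (intro exI[of _ "[:complex_of_real c:]"]) simp
next
  case (add f g)
  then show ?case by (metis of_real_add poly_add)
next
  case (mult f g)
  then show ?case by (metis of_real_mult poly_mult)
qed

text \<open>As \<open>S\<close> lies on the real line, the real and imaginary parts of
  \<open>f\<close> can be approximated by real polynomials separately;
  \<open>p + smult \<i> q\<close> joins them.\<close>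

lemma complex_poly_dense_on_real:
  assumes S: "compact S" "\<And>z. z \<in> S \<Longrightarrow> Im z = 0" and f: "continuous_on S f" and \<epsilon>: "\<epsilon> > 0"
  shows "\<exists>p. \<forall>z\<in>S. cmod (poly p z - f z) < \<epsilon>"
proof -
  let ?T = "Re ` S"
  have S': "complex_of_real (Re z) = z" if "z \<in> S" for z
    using S(2)[OF that] by (simp add: complex_eq_iff)
  have T: "compact ?T" using S(1) by (intro compact_continuous_image continuous_intros)
  have "continuous_on ?T (\<lambda>t. f (complex_of_real t))"
    by (rule continuous_on_compose2[OF f]) (auto intro!: continuous_intros simp: S')
  then have c: "continuous_on ?T (\<lambda>t. Re (f (complex_of_real t)))"
    "continuous_on ?T (\<lambda>t. Im (f (complex_of_real t)))"
    by (auto intro: continuous_intros)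
  obtain g where g: "real_polynomial_function g"
    "\<And>t. t \<in> ?T \<Longrightarrow> \<bar>Re (f (complex_of_real t)) - g t\<bar> < \<epsilon> / 2"
    using Stone_Weierstrass_real_polynomial_function[OF T c(1), of "\<epsilon> / 2"] \<epsilon> by auto
  obtain h where h: "real_polynomial_function h"
    "\<And>t. t \<in> ?T \<Longrightarrow> \<bar>Im (f (complex_of_real t)) - h t\<bar> < \<epsilon> / 2"
    using Stone_Weierstrass_real_polynomial_function[OF T c(2), of "\<epsilon> / 2"] \<epsilon> by auto
  obtain p q where p: "\<And>t. poly p (complex_of_real t) = complex_of_real (g t)"
    and q: "\<And>t. poly q (complex_of_real t) = complex_of_real (h t)"
    using real_polynomial_function_complex_poly g(1) h(1) by metis
  have "cmod (poly (p + smult \<i> q) z - f z) < \<epsilon>" if z: "z \<in> S" for z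
  proof -
    have "poly (p + smult \<i> q) z = complex_of_real (g (Re z)) + \<i> * complex_of_real (h (Re z))"
      using p[of "Re z"] q[of "Re z"] S'[OF z] by simp
    then have "cmod (poly (p + smult \<i> q) z - f z) \<le> \<bar>g (Re z) - Re (f z)\<bar> + \<bar>h (Re z) - Im (f z)\<bar>"
      using cmod_le[of "poly (p + smult \<i> q) z - f z"] by simp
    also have "\<dots> < \<epsilon>"
      using g(2)[of "Re z"] h(2)[of "Re z"] z S'[OF z] by (simp add: abs_minus_commute)
    finally show ?thesis .
  qed
  then show ?thesis by blast
qed

section \<open>Existence of the continuous functional calculus\<close>

context unital_cstar
begin

text \<open>A relation rather than a function: existence and uniqueness of the limit are proved
  separately, and each law of the calculus becomes a statement about sequences.\<close>

definition poly_limit :: "'a \<Rightarrow> (complex \<Rightarrow> complex) \<Rightarrow> 'a \<Rightarrow> bool" where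
  "poly_limit a f x \<longleftrightarrow> (\<exists>p. uniform_limit (spectrum A a) (\<lambda>n. poly (p n)) f sequentially \<and>
     (\<lambda>n. peval a (p n)) \<longlonglongrightarrow> x)"

lemma poly_limit_mem: "a \<in> A \<Longrightarrow> poly_limit a f x \<Longrightarrow> x \<in> A"
  unfolding poly_limit_def using closed closed_sequentially by (metis peval_mem)

lemma poly_limit_exists:
  assumes a: "a \<in> A" "star a = a" and f: "continuous_on (spectrum A a) f"
  shows "\<exists>x. poly_limit a f x"
proof -
  have "\<exists>p. \<forall>z\<in>spectrum A a. cmod (poly p z - f z) < inverse (real (Suc n))" for n
    using complex_poly_dense_on_real[OF compact_spectrum[OF a(1)] _ f] spectrum_selfadjoint_real[OF a]
    by simp
  then obtain p where p: "\<And>n z. z \<in> spectrum A a \<Longrightarrow> cmod (poly (p n) z - f z) < inverse (real (Suc n))"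
    by metis
  have u: "uniform_limit (spectrum A a) (\<lambda>n. poly (p n)) f sequentially"
  proof (rule uniform_limitI)
    fix \<epsilon> :: real assume "\<epsilon> > 0"
    then have "\<forall>\<^sub>F n in sequentially. inverse (real (Suc n)) < \<epsilon>"
      using LIMSEQ_inverse_real_of_nat order_tendstoD(2) by blast
    then show "\<forall>\<^sub>F n in sequentially. \<forall>z\<in>spectrum A a. dist (poly (p n) z) (f z) < \<epsilon>"
      by (rule eventually_mono) (use p in \<open>fastforce simp: dist_norm intro: less_trans\<close>)
  qed
  have "Cauchy (\<lambda>n. peval a (p n))"
  proof (rule CauchyI)
    fix \<epsilon> :: real assume \<epsilon>: "\<epsilon> > 0"
    \<comment> \<open>Two errors of \<open>\<epsilon> / 4\<close> give
      \<open>\<epsilon> / 2\<close>, which leaves room for the strict inequality, since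
      \<open>norm_peval_le\<close> only yields a weak one.\<close>
    then obtain N where N: "\<And>n z. n \<ge> N \<Longrightarrow> z \<in> spectrum A a \<Longrightarrow> dist (poly (p n) z) (f z) < \<epsilon> / 4"
      using u unfolding uniform_limit_sequentially_iff by (metis zero_less_divide_iff zero_less_numeral)
    have "norm (peval a (p m) - peval a (p n)) < \<epsilon>" if "m \<ge> N" "n \<ge> N" for m n
    proof -
      have "norm (peval a (p m - p n)) \<le> \<epsilon> / 2"
      proof (rule norm_peval_le[OF a])
        fix z assume z: "z \<in> spectrum A a"
        show "cmod (poly (p m - p n) z) \<le> \<epsilon> / 2"
          using dist_triangle2[of "poly (p m) z" "poly (p n) z" "f z"] N[OF that(1) z] N[OF that(2) z]
          by (simp add: dist_norm)
      qed (use \<epsilon> in auto)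
      then show ?thesis using \<epsilon> a by (simp add: peval_diff)
    qed
    then show "\<exists>N. \<forall>m\<ge>N. \<forall>n\<ge>N. norm (peval a (p m) - peval a (p n)) < \<epsilon>" by blast
  qed
  then show ?thesis using u Cauchy_convergent_iff convergent_def unfolding poly_limit_def by metis
qed

text \<open>\<open>norm_peval_le\<close> applied to the difference of the two approximating
  sequences. Letting \<open>f\<close> and \<open>g\<close> agree merely on the spectrum also
  provides the congruence law of the calculus.\<close>

lemma poly_limit_unique:
  assumes a: "a \<in> A" "star a = a" and x: "poly_limit a f x" and y: "poly_limit a g y"
    and fg: "\<And>z. z \<in> spectrum A a \<Longrightarrow> f z = g z"
  shows "x = y"
proof -
  obtain p where p: "uniform_limit (spectrum A a) (\<lambda>n. poly (p n)) f sequentially"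
    "(\<lambda>n. peval a (p n)) \<longlonglongrightarrow> x" using x poly_limit_def by blast
  obtain q where q: "uniform_limit (spectrum A a) (\<lambda>n. poly (q n)) g sequentially"
    "(\<lambda>n. peval a (q n)) \<longlonglongrightarrow> y" using y poly_limit_def by blast
  have lim: "(\<lambda>n. norm (peval a (p n - q n))) \<longlonglongrightarrow> norm (x - y)"
    using p(2) q(2) a by (auto simp: peval_diff intro!: tendsto_intros)
  have "norm (x - y) \<le> 0 + \<epsilon>" if \<epsilon>: "\<epsilon> > 0" for \<epsilon>
    unfolding add_0
  proof (rule tendsto_upperbound[OF lim])
    have "\<forall>\<^sub>F n in sequentially. \<forall>z\<in>spectrum A a. dist (poly (p n) z) (f z) < \<epsilon> / 2"
      "\<forall>\<^sub>F n in sequentially. \<forall>z\<in>spectrum A a. dist (poly (q n) z) (g z) < \<epsilon> / 2"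
      using uniform_limitD[OF p(1), of "\<epsilon> / 2"] uniform_limitD[OF q(1), of "\<epsilon> / 2"] \<epsilon> by auto
    then show "\<forall>\<^sub>F n in sequentially. norm (peval a (p n - q n)) \<le> \<epsilon>"
    proof eventually_elim
      case (elim n)
      show ?case
      proof (rule norm_peval_le[OF a])
        fix z assume z: "z \<in> spectrum A a"
        show "cmod (poly (p n - q n) z) \<le> \<epsilon>"
          using elim[THEN bspec[OF _ z]] dist_triangle2[of "poly (p n) z" "poly (q n) z" "f z"] fg[OF z]
          by (simp add: dist_norm)
      qed (use \<epsilon> in auto)
    qed
  qed simp
  then have "norm (x - y) \<le> 0" by (rule field_le_epsilon)
  then show ?thesis by simp
qed

lemma poly_limit_poly: "poly_limit a (poly p) (peval a p)"
  unfolding poly_limit_def by (intro exI[of _ "\<lambda>_. p"]) (simp add: uniform_limit_const)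

lemma poly_limit_add:
  "poly_limit a f x \<Longrightarrow> poly_limit a g y \<Longrightarrow> poly_limit a (\<lambda>z. f z + g z) (x + y)"
  unfolding poly_limit_def
proof (elim exE conjE)
  fix p q
  assume "uniform_limit (spectrum A a) (\<lambda>n. poly (p n)) f sequentially" "(\<lambda>n. peval a (p n)) \<longlonglongrightarrow> x"
    "uniform_limit (spectrum A a) (\<lambda>n. poly (q n)) g sequentially" "(\<lambda>n. peval a (q n)) \<longlonglongrightarrow> y"
  then show "\<exists>p. uniform_limit (spectrum A a) (\<lambda>n. poly (p n)) (\<lambda>z. f z + g z) sequentially \<and>
     (\<lambda>n. peval a (p n)) \<longlonglongrightarrow> x + y"
    by (intro exI[of _ "\<lambda>n. p n + q n"])
      (simp add: peval_add poly_add[abs_def] tendsto_add uniform_limit_add)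
qed

lemma poly_limit_mult:
  assumes a: "a \<in> A" and f: "continuous_on (spectrum A a) f" "continuous_on (spectrum A a) g"
    and x: "poly_limit a f x" and y: "poly_limit a g y"
  shows "poly_limit a (\<lambda>z. f z * g z) (x * y)"
proof -
  obtain p where p: "uniform_limit (spectrum A a) (\<lambda>n. poly (p n)) f sequentially"
    "(\<lambda>n. peval a (p n)) \<longlonglongrightarrow> x" using x poly_limit_def by blast
  obtain q where q: "uniform_limit (spectrum A a) (\<lambda>n. poly (q n)) g sequentially"
    "(\<lambda>n. peval a (q n)) \<longlonglongrightarrow> y" using y poly_limit_def by blast
  have "bounded (f ` spectrum A a)" "bounded (g ` spectrum A a)"
    using compact_continuous_image[OF _ compact_spectrum[OF a]] f compact_imp_bounded by blast+
  from uniform_lim_mult[OF p(1) q(1) this] tendsto_mult[OF p(2) q(2)] show ?thesis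
    unfolding poly_limit_def
    by (intro exI[of _ "\<lambda>n. p n * q n"]) (simp add: peval_mult a poly_mult[abs_def])
qed

lemma poly_limit_cnj:
  assumes a: "a \<in> A" "star a = a" and x: "poly_limit a f x"
  shows "poly_limit a (\<lambda>z. cnj (f z)) (star x)"
proof -
  obtain p where p: "uniform_limit (spectrum A a) (\<lambda>n. poly (p n)) f sequentially"
    "(\<lambda>n. peval a (p n)) \<longlonglongrightarrow> x" using x poly_limit_def by blast
  have *: "poly (map_poly cnj q) z = cnj (poly q z)" if "z \<in> spectrum A a" for q z
  proof -
    have "cnj z = z" using spectrum_selfadjoint_real[OF a that] by (simp add: complex_eq_iff)
    then show ?thesis using poly_cnj[of q z] by simp
  qed
  have "dist (poly (map_poly cnj q) z) (cnj (f z)) = dist (poly q z) (f z)"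
    if "z \<in> spectrum A a" for q z
    unfolding *[OF that] dist_norm by (metis complex_cnj_diff complex_mod_cnj)
  then have "uniform_limit (spectrum A a) (\<lambda>n. poly (map_poly cnj (p n))) (\<lambda>z. cnj (f z)) sequentially"
    using p(1) unfolding uniform_limit_sequentially_iff by simp
  then show ?thesis unfolding poly_limit_def
    using tendsto_star[OF p(2)] a by (auto simp: star_peval)
qed

text \<open>\<open>\<Phi> f\<close> is any polynomial limit for \<open>f\<close>. In each law both
  sides are limits for the same function, hence equal by uniqueness.\<close>

theorem is_cfc_exists:
  assumes a: "a \<in> A" "star a = a"
  shows "\<exists>\<Phi>. is_cfc A a \<Phi>"
proof -
  define \<Phi> where "\<Phi> f = (SOME x. poly_limit a f x)" for f
  have lim: "poly_limit a f (\<Phi> f)" if "continuous_on (spectrum A a) f" for f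
    unfolding \<Phi>_def using poly_limit_exists[OF a that] by (rule someI_ex)
  note eqI = poly_limit_unique[OF a lim]
  have dom: "cfc_dom A a = {f. continuous_on (spectrum A a) f}" by (simp add: cfc_dom_def)
  have const: "poly_limit a (\<lambda>z. c) (c *\<^sub>C e)" for c
  proof -
    have "poly [:c:] = (\<lambda>z. c)" by (simp add: fun_eq_iff)
    then show ?thesis using poly_limit_poly[of a "[:c:]"] by simp
  qed
  have id: "poly_limit a (\<lambda>z. z) a"
  proof -
    have "poly [:0, 1:] = (\<lambda>z::complex. z)" by (simp add: fun_eq_iff)
    then show ?thesis using poly_limit_poly[of a "[:0, 1:]"] a by simp
  qed
  have scale: "poly_limit a (\<lambda>z. c * f z) (c *\<^sub>C \<Phi> f)" if "continuous_on (spectrum A a) f" for c f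
    using poly_limit_mult[OF a(1) _ that const lim[OF that], of c] poly_limit_mem[OF a(1) lim[OF that]]
    by (simp add: mult_scaleC_left)
  have "is_cfc A a \<Phi>"
    unfolding is_cfc_def dom
  proof (intro conjI ballI allI impI, unfold mem_Collect_eq)
    fix f :: "complex \<Rightarrow> complex" assume f: "continuous_on (spectrum A a) f"
    show "\<Phi> f \<in> A" using poly_limit_mem[OF a(1) lim[OF f]] .
    show "\<Phi> (\<lambda>z. cnj (f z)) = star (\<Phi> f)"
      using f by (intro eqI[OF _ poly_limit_cnj[OF a lim]] continuous_intros) auto
    show "\<Phi> (\<lambda>z. c * f z) = c *\<^sub>C \<Phi> f" for c
      using f scale by (intro eqI[of _ "\<lambda>z. c * f z"] continuous_intros) auto
    fix g :: "complex \<Rightarrow> complex" assume g: "continuous_on (spectrum A a) g"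
    show "\<Phi> (\<lambda>z. f z + g z) = \<Phi> f + \<Phi> g"
      using f g by (intro eqI[OF _ poly_limit_add[OF lim lim]] continuous_intros) auto
    show "\<Phi> (\<lambda>z. f z * g z) = \<Phi> f * \<Phi> g"
      using f g a by (intro eqI[OF _ poly_limit_mult[OF _ _ _ lim lim]] continuous_intros) auto
    show "\<Phi> f = \<Phi> g" if "\<forall>z\<in>spectrum A a. f z = g z"
      using f g that by (intro eqI[OF _ lim]) auto
  next
    show "\<Phi> (\<lambda>z. z) = a"
      using id by (intro eqI[of _ "\<lambda>z. z"] continuous_intros) auto
    show "\<Phi> (\<lambda>z. 1) = unit_of A"
      using const[of 1] by (intro eqI[of _ "\<lambda>z. 1"] continuous_intros) auto
  qed
  then show ?thesis by blast
qed

end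

section \<open>Consequences of the laws of a functional calculus\<close>

locale functional_calculus = unital_cstar +
  fixes a :: 'a and \<Phi> :: "(complex \<Rightarrow> complex) \<Rightarrow> 'a"
  assumes mem: "a \<in> A" and selfadjoint: "star a = a" and is_cfc: "is_cfc A a \<Phi>"
begin

lemma cfc_dom_eq: "cfc_dom A a = {f. continuous_on (spectrum A a) f}"
  by (simp add: cfc_dom_def)

lemma cfc_mem: "continuous_on (spectrum A a) f \<Longrightarrow> \<Phi> f \<in> A"
  and cfc_cong: "continuous_on (spectrum A a) f \<Longrightarrow> continuous_on (spectrum A a) g \<Longrightarrow>
    (\<And>z. z \<in> spectrum A a \<Longrightarrow> f z = g z) \<Longrightarrow> \<Phi> f = \<Phi> g"
  and cfc_add: "continuous_on (spectrum A a) f \<Longrightarrow> continuous_on (spectrum A a) g \<Longrightarrow>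
    \<Phi> (\<lambda>z. f z + g z) = \<Phi> f + \<Phi> g"
  and cfc_mult: "continuous_on (spectrum A a) f \<Longrightarrow> continuous_on (spectrum A a) g \<Longrightarrow>
    \<Phi> (\<lambda>z. f z * g z) = \<Phi> f * \<Phi> g"
  and cfc_scaleC: "continuous_on (spectrum A a) f \<Longrightarrow> \<Phi> (\<lambda>z. c * f z) = c *\<^sub>C \<Phi> f"
  and cfc_cnj: "continuous_on (spectrum A a) f \<Longrightarrow> \<Phi> (\<lambda>z. cnj (f z)) = star (\<Phi> f)"
  and cfc_id: "\<Phi> (\<lambda>z. z) = a"
  and cfc_one: "\<Phi> (\<lambda>z. 1) = e"
proof -
  note [simp] = cfc_dom_eq
  note * = is_cfc[unfolded is_cfc_def]
  show "continuous_on (spectrum A a) f \<Longrightarrow> \<Phi> f \<in> A"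
    using *[THEN conjunct1, rule_format, of f] by simp
  show "continuous_on (spectrum A a) f \<Longrightarrow> continuous_on (spectrum A a) g \<Longrightarrow>
    (\<And>z. z \<in> spectrum A a \<Longrightarrow> f z = g z) \<Longrightarrow> \<Phi> f = \<Phi> g"
    using *[THEN conjunct2, THEN conjunct1, rule_format, of f g] by simp
  show "continuous_on (spectrum A a) f \<Longrightarrow> continuous_on (spectrum A a) g \<Longrightarrow>
    \<Phi> (\<lambda>z. f z + g z) = \<Phi> f + \<Phi> g"
    using *[THEN conjunct2, THEN conjunct2, THEN conjunct1, rule_format, of f g] by simp
  show "continuous_on (spectrum A a) f \<Longrightarrow> continuous_on (spectrum A a) g \<Longrightarrow>
    \<Phi> (\<lambda>z. f z * g z) = \<Phi> f * \<Phi> g"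
    using *[THEN conjunct2, THEN conjunct2, THEN conjunct2, THEN conjunct1, rule_format, of f g] by simp
  show "continuous_on (spectrum A a) f \<Longrightarrow> \<Phi> (\<lambda>z. c * f z) = c *\<^sub>C \<Phi> f"
    using *[THEN conjunct2, THEN conjunct2, THEN conjunct2, THEN conjunct2, THEN conjunct1, rule_format, of f c] by simp
  show "continuous_on (spectrum A a) f \<Longrightarrow> \<Phi> (\<lambda>z. cnj (f z)) = star (\<Phi> f)"
    using *[THEN conjunct2, THEN conjunct2, THEN conjunct2, THEN conjunct2, THEN conjunct2, THEN conjunct1, rule_format, of f] by simp
  show "\<Phi> (\<lambda>z. z) = a" "\<Phi> (\<lambda>z. 1) = e"
    using *[THEN conjunct2, THEN conjunct2, THEN conjunct2, THEN conjunct2, THEN conjunct2, THEN conjunct2] by simp_all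
qed

lemma cfc_const: "\<Phi> (\<lambda>z. c) = c *\<^sub>C e"
  using cfc_scaleC[of "\<lambda>z. 1" c] by (simp add: cfc_one)

lemma cfc_diff:
  assumes "continuous_on (spectrum A a) f" "continuous_on (spectrum A a) g"
  shows "\<Phi> (\<lambda>z. f z - g z) = \<Phi> f - \<Phi> g"
  using cfc_add[OF assms(1), of "\<lambda>z. (-1) * g z"] cfc_scaleC[OF assms(2), of "-1"] assms(2)
  by (simp add: continuous_on_minus)

text \<open>If \<open>f\<close> omits \<open>\<mu>\<close> on the spectrum, then
  \<open>1 / (\<mu> - f z)\<close> is continuous there, and the calculus turns it into an
  inverse.\<close>

lemma spectrum_cfc:
  assumes f: "continuous_on (spectrum A a) f" and \<mu>: "\<mu> \<in> spectrum A (\<Phi> f)"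
  shows "\<exists>w\<in>spectrum A a. f w = \<mu>"
proof (rule ccontr)
  assume "\<not> ?thesis"
  then have ne: "\<mu> - f z \<noteq> 0" if "z \<in> spectrum A a" for z using that by auto
  let ?g = "\<lambda>z. 1 / (\<mu> - f z)" and ?h = "\<lambda>z. \<mu> - f z"
  have g: "continuous_on (spectrum A a) ?g" and h: "continuous_on (spectrum A a) ?h"
    using ne f by (auto intro!: continuous_intros)
  have "\<Phi> ?g * \<Phi> ?h = e" "\<Phi> ?h * \<Phi> ?g = e"
    unfolding cfc_mult[OF g h, symmetric] cfc_mult[OF h g, symmetric] cfc_one[symmetric]
    using g h ne by (auto intro!: cfc_cong continuous_on_mult)
  moreover have "\<Phi> ?h = \<mu> *\<^sub>C e - \<Phi> f"
    using cfc_diff[of "\<lambda>z. \<mu>" f] f by (simp add: cfc_const)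
  ultimately have "inverses A e (\<mu> *\<^sub>C e - \<Phi> f) (\<Phi> ?g)"
    using cfc_mem[OF f] cfc_mem[OF g] by (simp add: inverses_def)
  then show False using \<mu> spectrum_iff cfc_mem[OF f] by blast
qed

text \<open>Continuity is not among the laws in \<open>is_cfc\<close>; it is automatic. The argument
  for polynomials applies again, with \<open>spectrum_cfc\<close> in place of factorization.\<close>

lemma norm_cfc_le:
  assumes f: "continuous_on (spectrum A a) f" and M: "0 \<le> M" "\<And>z. z \<in> spectrum A a \<Longrightarrow> cmod (f z) \<le> M"
  shows "norm (\<Phi> f) \<le> M"
proof (cases "e = 0")
  case True
  show ?thesis using eq_zero_of_unit_zero[OF True cfc_mem[OF f]] M by simp
next
  case False
  let ?h = "\<lambda>z. cnj (f z) * f z"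
  have c: "continuous_on (spectrum A a) (\<lambda>z. cnj (f z))" "continuous_on (spectrum A a) ?h"
    using f by (auto intro!: continuous_intros)
  have h: "\<Phi> ?h = star (\<Phi> f) * \<Phi> f"
    using cfc_mult[OF c(1) f] cfc_cnj[OF f] by simp
  have "star (\<Phi> ?h) = \<Phi> ?h" by (simp add: h star_mult star_star)
  then obtain \<mu> where \<mu>: "\<mu> \<in> spectrum A (\<Phi> ?h)" "cmod \<mu> = (norm (\<Phi> f))\<^sup>2"
    using spectral_radius_selfadjoint[of "\<Phi> ?h"] cfc_mem[OF c(2)] False
    by (auto simp: h cstar_identity)
  then obtain w where "w \<in> spectrum A a" "cnj (f w) * f w = \<mu>"
    using spectrum_cfc[OF c(2)] by blast
  then have "(norm (\<Phi> f))\<^sup>2 = (cmod (f w))\<^sup>2" "w \<in> spectrum A a"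
    using \<mu>(2) by (auto simp: norm_mult power2_eq_square)
  then show ?thesis using M(2) by (metis norm_ge_zero power2_eq_imp_eq)
qed

end

text \<open>The map chosen by \<open>cfc\<close> is known solely through \<open>is_cfc\<close>,
  which is why the locale argues from those laws and not from polynomial limits.\<close>

lemma (in unital_cstar) functional_calculus_cfc:
  assumes "a \<in> A" "star a = a"
  shows "functional_calculus A e a (cfc A a)"
proof
  show "is_cfc A a (cfc A a)"
    unfolding cfc_def using is_cfc_exists[OF assms] by (rule someI_ex)
qed (use assms in auto)

context functional_calculus
begin

text \<open>The spectrum is real, so nothing is lost by reading a function only through
  \<open>Re\<close>. The function used in \<open>pos_cut\<close> has exactly this shape.\<close>

definition rcfc :: "(real \<Rightarrow> real) \<Rightarrow> 'a" where
  "rcfc k = \<Phi> (\<lambda>z. complex_of_real (k (Re z)))"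

lemma continuous_on_of_real_Re:
  "continuous_on UNIV k \<Longrightarrow> continuous_on S (\<lambda>z. complex_of_real (k (Re z)))"
  by (intro continuous_intros continuous_on_compose2[of UNIV k _ Re]) auto

lemma spectrum_of_real_Re: "z \<in> spectrum A a \<Longrightarrow> complex_of_real (Re z) = z"
  using spectrum_selfadjoint_real[OF mem selfadjoint] by (simp add: complex_eq_iff)

context
  fixes k :: "real \<Rightarrow> real"
  assumes k: "continuous_on UNIV k"
begin

lemma rcfc_mem: "rcfc k \<in> A"
  unfolding rcfc_def using k by (intro cfc_mem continuous_on_of_real_Re)

lemma rcfc_selfadjoint: "star (rcfc k) = rcfc k"
  using cfc_cnj[OF continuous_on_of_real_Re[OF k]] by (simp add: rcfc_def)

lemma rcfc_scaleR: "rcfc (\<lambda>t. c * k t) = c *\<^sub>R rcfc k"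
  using cfc_scaleC[OF continuous_on_of_real_Re[OF k], of "complex_of_real c"]
  by (simp add: rcfc_def scaleR_scaleC)

lemma spectrum_rcfc: "\<mu> \<in> spectrum A (rcfc k) \<Longrightarrow> \<exists>w\<in>spectrum A a. \<mu> = complex_of_real (k (Re w))"
  unfolding rcfc_def using spectrum_cfc[OF continuous_on_of_real_Re[OF k]] by metis

lemma norm_rcfc_le:
  "0 \<le> M \<Longrightarrow> (\<And>z. z \<in> spectrum A a \<Longrightarrow> \<bar>k (Re z)\<bar> \<le> M) \<Longrightarrow> norm (rcfc k) \<le> M"
  unfolding rcfc_def by (intro norm_cfc_le continuous_on_of_real_Re[OF k]) auto

end

context
  fixes k l :: "real \<Rightarrow> real"
  assumes k: "continuous_on UNIV k" and l: "continuous_on UNIV l"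
begin

lemma rcfc_add: "rcfc (\<lambda>t. k t + l t) = rcfc k + rcfc l"
  using cfc_add[OF continuous_on_of_real_Re[OF k] continuous_on_of_real_Re[OF l]]
  by (simp add: rcfc_def)

lemma rcfc_diff: "rcfc (\<lambda>t. k t - l t) = rcfc k - rcfc l"
  using cfc_diff[OF continuous_on_of_real_Re[OF k] continuous_on_of_real_Re[OF l]]
  by (simp add: rcfc_def)

lemma rcfc_mult: "rcfc (\<lambda>t. k t * l t) = rcfc k * rcfc l"
  using cfc_mult[OF continuous_on_of_real_Re[OF k] continuous_on_of_real_Re[OF l]]
  by (simp add: rcfc_def)

end

lemma rcfc_const: "rcfc (\<lambda>t. c) = c *\<^sub>R e"
  by (simp add: rcfc_def cfc_const scaleR_scaleC)

lemma rcfc_id: "rcfc (\<lambda>t. t) = a"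
proof -
  have "\<Phi> (\<lambda>z. complex_of_real (Re z)) = \<Phi> (\<lambda>z. z)"
    by (intro cfc_cong continuous_intros) (auto simp: spectrum_of_real_Re)
  then show ?thesis by (simp add: rcfc_def cfc_id)
qed

end

section \<open>Positive elements, Cuntz comparison and subalgebras\<close>

context unital_cstar
begin

lemma pos_iff: "x \<in> pos A \<longleftrightarrow>
  x \<in> A \<and> star x = x \<and> (\<forall>z\<in>spectrum A x. Im z = 0 \<and> 0 \<le> Re z)"
  by (auto simp: pos_def complex_is_Real_iff)

lemma norm_le_of_spectrum:
  assumes x: "x \<in> A" "star x = x" and M: "0 \<le> M" "\<And>z. z \<in> spectrum A x \<Longrightarrow> cmod z \<le> M"
  shows "norm x \<le> M"
proof (cases "e = 0")
  case True
  show ?thesis using eq_zero_of_unit_zero[OF True x(1)] M by simp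
next
  case False
  then show ?thesis using spectral_radius_selfadjoint[OF x False] M by force
qed

lemma spectrum_unit_diff:
  assumes x: "x \<in> A" and z: "z \<in> spectrum A (e - x)"
  shows "1 - z \<in> spectrum A x"
proof (rule ccontr)
  assume "1 - z \<notin> spectrum A x"
  then obtain y where "inverses A e ((1 - z) *\<^sub>C e - x) y" using spectrum_iff x by blast
  from inverses_scaleC[OF this, of "-1"] have "inverses A e (z *\<^sub>C e - (e - x)) (- y)"
    by (simp add: scaleC_diff_left algebra_simps)
  then show False using z x spectrum_iff by blast
qed

lemma unit_diff_pos:
  assumes x: "x \<in> pos A" "norm x \<le> 1"
  shows "e - x \<in> pos A" "norm (e - x) \<le> 1"
proof -
  have xA: "x \<in> A" "star x = x" using x by (auto simp: pos_iff)
  have *: "Im z = 0 \<and> 0 \<le> Re z \<and> Re z \<le> 1" if "z \<in> spectrum A (e - x)" for z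
  proof -
    have z: "1 - z \<in> spectrum A x" using spectrum_unit_diff xA that by blast
    then have "cmod (1 - z) \<le> 1" using norm_le_of_mem_spectrum xA x by force
    then have "Re (1 - z) \<le> 1" using complex_Re_le_cmod order_trans by blast
    moreover have "Im (1 - z) = 0 \<and> 0 \<le> Re (1 - z)" using z x by (auto simp only: pos_iff)
    ultimately show ?thesis by simp
  qed
  then show "e - x \<in> pos A" using xA by (auto simp: pos_iff star_diff)
  have "cmod z \<le> 1" if "z \<in> spectrum A (e - x)" for z
    using *[OF that] by (simp add: cmod_eq_Re)
  then show "norm (e - x) \<le> 1"
    using xA by (intro norm_le_of_spectrum) (auto simp: star_diff)
qed

lemma unit_pos: "e \<in> pos A"
proof -
  have "z = 1" if "z \<in> spectrum A e" for z
  proof (rule ccontr)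
    assume z: "z \<noteq> 1"
    have "inverses A e e e" by (simp add: inverses_def)
    from inverses_scaleC[OF this, of "z - 1"] z
    have "inverses A e (z *\<^sub>C e - e) (inverse (z - 1) *\<^sub>C e)" by (simp add: scaleC_diff_left)
    then show False using that spectrum_iff by blast
  qed
  then show ?thesis by (force simp: pos_iff)
qed

lemma scaleR_pos:
  assumes x: "x \<in> pos A" and t: "t > 0"
  shows "t *\<^sub>R x \<in> pos A"
proof -
  have xA: "x \<in> A" "star x = x" using x by (auto simp: pos_iff)
  have "Im z = 0 \<and> 0 \<le> Re z" if z: "z \<in> spectrum A (t *\<^sub>R x)" for z
  proof -
    have "z / complex_of_real t \<in> spectrum A x"
    proof (rule ccontr)
      assume "\<not> ?thesis"
      then obtain y where "inverses A e ((z / complex_of_real t) *\<^sub>C e - x) y"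
        using spectrum_iff xA by blast
      from inverses_scaleC[OF this, of "complex_of_real t"] t
      have "inverses A e (z *\<^sub>C e - t *\<^sub>R x) (inverse (complex_of_real t) *\<^sub>C y)"
        by (simp add: scaleC_diff_right scaleC_scaleC scaleR_scaleC)
      then show False using z xA spectrum_iff scaleR_mem by blast
    qed
    then have "Im (z / complex_of_real t) = 0 \<and> 0 \<le> Re (z / complex_of_real t)"
      using x by (auto simp only: pos_iff)
    then show ?thesis using t by (auto simp: zero_le_divide_iff)
  qed
  then show ?thesis using xA by (auto simp: pos_iff star_scaleR)
qed

text \<open>\<open>h\<close> comes from sqrt((t - \<epsilon>)_+ / t). Written as
  \<open>h * x * h\<close>, the cut-down inherits Cuntz comparison from \<open>x\<close> by
  conjugation, without any approximation.\<close>

lemma pos_cut_eq_conj: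
  assumes x: "x \<in> A" "star x = x" and \<epsilon>: "\<epsilon> > 0"
  shows "\<exists>h\<in>A. star h = h \<and> pos_cut A x \<epsilon> = h * x * h"
proof -
  interpret functional_calculus A e x "cfc A x"
    using x by (rule functional_calculus_cfc)
  \<comment> \<open>\<open>max t \<epsilon>\<close> equals \<open>t\<close> wherever the numerator
    is nonzero and keeps the denominator away from 0 elsewhere.\<close>
  let ?h = "\<lambda>t. sqrt (max (t - \<epsilon>) 0 / max t \<epsilon>)"
  have "max t \<epsilon> \<noteq> 0" for t using \<epsilon> by (auto simp: max_def)
  then have h: "continuous_on UNIV ?h" by (intro continuous_intros) auto
  have *: "?h t * t * ?h t = max (t - \<epsilon>) 0" for t
  proof (cases "t > \<epsilon>")
    case True
    then have "?h t * ?h t = (t - \<epsilon>) / t" using \<epsilon> by (simp add: max_def)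
    then have "t * (?h t * ?h t) = t - \<epsilon>" using True \<epsilon> by simp
    then show ?thesis using True by (simp add: mult_ac)
  qed simp
  have "continuous_on UNIV (\<lambda>t. ?h t * t)" by (rule continuous_on_mult[OF h continuous_on_id])
  then have "rcfc ?h * x * rcfc ?h = rcfc (\<lambda>t. ?h t * t * ?h t)"
    by (simp only: rcfc_mult rcfc_id h continuous_on_id)
  then have "pos_cut A x \<epsilon> = rcfc ?h * x * rcfc ?h"
    unfolding * by (simp add: pos_cut_def rcfc_def)
  then show ?thesis using rcfc_mem[OF h] rcfc_selfadjoint[OF h] by blast
qed

section \<open>Cuntz comparison under conjugation and scaling\<close>

lemma cuntz_le_iff:
  "cuntz_le A x y \<longleftrightarrow> (\<exists>v. (\<forall>n. v n \<in> A) \<and> (\<lambda>n. v n * y * star (v n)) \<longlonglongrightarrow> x)"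
  unfolding cuntz_le_def by (simp add: tendsto_norm_zero_iff LIM_zero_iff)

lemma cuntz_le_conj:
  assumes "cuntz_le A x y" "c \<in> A"
  shows "cuntz_le A (c * x * star c) y"
proof -
  obtain v where v: "\<And>n. v n \<in> A" "(\<lambda>n. v n * y * star (v n)) \<longlonglongrightarrow> x"
    using assms cuntz_le_iff by blast
  have "(\<lambda>n. c * (v n * y * star (v n)) * star c) \<longlonglongrightarrow> c * x * star c"
    by (intro tendsto_intros v)
  then have "(\<lambda>n. (c * v n) * y * star (c * v n)) \<longlonglongrightarrow> c * x * star c"
    by (simp add: star_mult mult.assoc)
  then show ?thesis using v(1) assms(2) cuntz_le_iff by (metis mult_mem)
qed

text \<open>The factors are absorbed into the comparing sequence as
  \<open>sqrt (t/s)\<close>.\<close>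

lemma cuntz_le_scaleR:
  assumes "cuntz_le A (s *\<^sub>R x) (t *\<^sub>R y)" and s: "s > 0" and t: "t > 0"
  shows "cuntz_le A x y"
proof -
  obtain v where v: "\<And>n. v n \<in> A" "(\<lambda>n. v n * (t *\<^sub>R y) * star (v n)) \<longlonglongrightarrow> s *\<^sub>R x"
    using assms cuntz_le_iff by blast
  have "(\<lambda>n. (1/s) *\<^sub>R (v n * (t *\<^sub>R y) * star (v n))) \<longlonglongrightarrow> (1/s) *\<^sub>R (s *\<^sub>R x)"
    by (intro tendsto_intros v)
  moreover have "(1/s) *\<^sub>R (v n * (t *\<^sub>R y) * star (v n)) =
      (sqrt (t/s) *\<^sub>R v n) * y * star (sqrt (t/s) *\<^sub>R v n)" for n
    using s t by (simp add: star_scaleR)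
  ultimately have "(\<lambda>n. (sqrt (t/s) *\<^sub>R v n) * y * star (sqrt (t/s) *\<^sub>R v n)) \<longlonglongrightarrow> x"
    using s by simp
  then show ?thesis using v(1) cuntz_le_iff by (metis scaleR_mem)
qed

end

section \<open>A subalgebra with its own unit, and the orthogonal corner\<close>

locale unital_cstar_subalgebra = unital_cstar A e + B: unital_cstar B p
  for A B :: "'a::cstar_algebra set" and e p :: 'a +
  assumes subset: "B \<subseteq> A"
begin

lemma sub_mem: "x \<in> B \<Longrightarrow> x \<in> A"
  using subset by blast

lemma corner_zero: "x \<in> B \<Longrightarrow> x * (e - p) = 0" "x \<in> B \<Longrightarrow> (e - p) * x = 0"
  by (simp_all add: sub_mem right_diff_distrib left_diff_distrib)

lemma corner_idem: "(e - p) * (e - p) = e - p"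
  by (simp add: sub_mem right_diff_distrib left_diff_distrib)

text \<open>An inverse in \<open>A\<close> is assembled from an inverse in \<open>B\<close> and
  \<open>inverse z\<close> on the corner \<open>e - p\<close>. The corner part requires
  \<open>z \<noteq> 0\<close>, whence the extra point 0.\<close>

lemma spectrum_subalgebra:
  assumes x: "x \<in> B"
  shows "spectrum A x \<subseteq> insert 0 (spectrum B x)"
proof
  fix z assume z: "z \<in> spectrum A x"
  show "z \<in> insert 0 (spectrum B x)"
  proof (rule ccontr)
    assume *: "\<not> ?thesis"
    then obtain c where c: "inverses B p (z *\<^sub>C p - x) c" using B.spectrum_iff x by blast
    define u where "u = z *\<^sub>C p - x"
    have u: "u \<in> B" "c \<in> B" "u * c = p" "c * u = p" using c by (auto simp: u_def inverses_def)
    have "z *\<^sub>C e - x = u + z *\<^sub>C (e - p)" by (simp add: u_def scaleC_diff_right)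
    moreover have "inverses A e (u + z *\<^sub>C (e - p)) (c + inverse z *\<^sub>C (e - p))"
      using u * by (simp add: inverses_def sub_mem distrib_left distrib_right mult_scaleC_left
          mult_scaleC_right corner_zero corner_idem scaleC_scaleC)
    ultimately show False using z x sub_mem spectrum_iff by metis
  qed
qed

lemma pos_sub: "x \<in> pos B \<Longrightarrow> x \<in> pos A"
  using spectrum_subalgebra[of x] by (auto simp: pos_iff B.pos_iff sub_mem)

text \<open>In \<open>A\<close>, the element \<open>r\<close> is the orthogonal sum of \<open>r\<close> in \<open>B\<close> and the zero of the corner \<open>e - p\<close>.
  So the calculus of \<open>e - r\<close> in \<open>A\<close>, written in the variable of \<open>r\<close>, differs from
  the calculus of \<open>r\<close> in \<open>B\<close> by the value at 0 on that corner.\<close>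

lemma rcfc_corner:
  assumes \<Phi>: "functional_calculus A e (e - r) \<Phi>" and \<Psi>: "functional_calculus B p r \<Psi>"
    and r: "r \<in> pos B" "norm r \<le> 1" and k: "continuous_on UNIV k"
  shows "functional_calculus.rcfc \<Phi> (\<lambda>t. k (1 - t)) = functional_calculus.rcfc \<Psi> k + k 0 *\<^sub>R (e - p)"
proof -
  interpret C: functional_calculus A e "e - r" \<Phi> by (rule \<Phi>)
  interpret D: functional_calculus B p r \<Psi> by (rule \<Psi>)
  have cont: "continuous_on UNIV (\<lambda>t. g (1 - t))" if "continuous_on UNIV g" for g :: "real \<Rightarrow> real"
    by (rule continuous_on_compose2[OF that]) (auto intro: continuous_intros)
  have bound: "Re z \<in> {0..1}" if "z \<in> spectrum B r" for z
  proof -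
    have "Re z \<le> 1" "0 \<le> Re z"
      using that r B.norm_le_of_mem_spectrum[OF D.mem that] complex_Re_le_cmod[of z]
      by (auto simp: B.pos_iff)
    then show ?thesis by simp
  qed
  have bound': "1 - Re z \<in> {0..1}" if "z \<in> spectrum A (e - r)" for z
  proof -
    have "1 - z \<in> insert 0 (spectrum B r)"
      using spectrum_unit_diff[OF sub_mem[OF D.mem] that] spectrum_subalgebra[OF D.mem] by blast
    then have "Re (1 - z) \<in> {0..1}" using bound[of "1 - z"] by auto
    then show ?thesis by simp
  qed
  \<comment> \<open>Polynomials are settled by induction: the linear case reduces to the identity
    function, the product case to orthogonality of \<open>B\<close> and the idempotent
    \<open>e - p\<close>.\<close>
  have poly: "continuous_on UNIV g \<and> C.rcfc (\<lambda>t. g (1 - t)) = D.rcfc g + g 0 *\<^sub>R (e - p)"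
    if "real_polynomial_function g" for g
    using that
  proof (induction rule: real_polynomial_function.induct)
    case (linear f)
    then have c: "continuous_on UNIV f" by (rule linear_continuous_on)
    have "f t = f 1 * t" for t
      using linear_simps(5)[OF linear, of t 1] by simp
    then obtain m where f: "f = (\<lambda>t. m * t)" by blast
    have "C.rcfc (\<lambda>t. m * (1 - t)) = m *\<^sub>R r"
      using C.rcfc_scaleR[of "\<lambda>t. 1 - t"] C.rcfc_diff[of "\<lambda>t. 1" "\<lambda>t. t"]
      by (simp add: continuous_intros C.rcfc_const C.rcfc_id)
    moreover have "D.rcfc (\<lambda>t. m * t) = m *\<^sub>R r"
      using D.rcfc_scaleR[of "\<lambda>t. t"] by (simp add: continuous_intros D.rcfc_id)
    ultimately show ?case using c by (simp add: f)
  next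
    case (const c)
    then show ?case by (simp add: C.rcfc_const D.rcfc_const scaleR_diff_right)
  next
    case (add f g)
    then show ?case
      using C.rcfc_add[of "\<lambda>t. f (1 - t)" "\<lambda>t. g (1 - t)"] D.rcfc_add[of f g]
      by (simp add: cont continuous_on_add scaleR_add_left)
  next
    case (mult f g)
    then have "D.rcfc f \<in> B" "D.rcfc g \<in> B" using D.rcfc_mem by auto
    then have "(D.rcfc f + f 0 *\<^sub>R (e - p)) * (D.rcfc g + g 0 *\<^sub>R (e - p)) =
        D.rcfc f * D.rcfc g + (f 0 * g 0) *\<^sub>R (e - p)"
      by (simp add: distrib_left distrib_right corner_zero corner_idem)
    then show ?case
      using mult C.rcfc_mult[of "\<lambda>t. f (1 - t)" "\<lambda>t. g (1 - t)"] D.rcfc_mult[of f g]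
      by (simp add: cont continuous_on_mult)
  qed
  let ?x = "C.rcfc (\<lambda>t. k (1 - t)) - (D.rcfc k + k 0 *\<^sub>R (e - p))"
  have "norm ?x \<le> 0 + \<epsilon>" if \<epsilon>: "\<epsilon> > 0" for \<epsilon>
  proof -
    \<comment> \<open>Replacing \<open>k\<close> by a polynomial costs \<open>\<delta>\<close> in
      each of the two calculi, and \<open>\<delta> * norm (e - p)\<close> through the value at
      0.\<close>
    define K where "K = 2 + norm (e - p)"
    have K: "K > 0" by (simp add: K_def add_pos_nonneg)
    define \<delta> where "\<delta> = \<epsilon> / K"
    have \<delta>: "\<delta> > 0" "\<delta> * K = \<epsilon>" using \<epsilon> K by (auto simp: \<delta>_def)
    obtain g where g: "real_polynomial_function g" "\<And>t. t \<in> {0..1} \<Longrightarrow> \<bar>k t - g t\<bar> < \<delta>"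
      using Stone_Weierstrass_real_polynomial_function[of "{0..1}" k \<delta>] \<delta>
        continuous_on_subset[OF k] by auto
    note gc = poly[OF g(1), THEN conjunct1]
    have 1: "norm (C.rcfc (\<lambda>t. k (1 - t)) - C.rcfc (\<lambda>t. g (1 - t))) \<le> \<delta>"
      unfolding C.rcfc_diff[OF cont[OF k] cont[OF gc], symmetric]
      using bound' g(2) \<delta>
      by (intro C.norm_rcfc_le continuous_on_diff cont k gc) (auto simp: less_imp_le)
    have 2: "norm (D.rcfc k - D.rcfc g) \<le> \<delta>"
      unfolding D.rcfc_diff[OF k gc, symmetric]
      using bound g(2) \<delta>
      by (intro D.norm_rcfc_le continuous_on_diff k gc) (auto simp: less_imp_le)
    have 3: "norm ((k 0 - g 0) *\<^sub>R (e - p)) \<le> \<delta> * norm (e - p)"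
      using g(2)[of 0] by (simp add: mult_right_mono)
    have "?x = (C.rcfc (\<lambda>t. k (1 - t)) - C.rcfc (\<lambda>t. g (1 - t)))
        - (D.rcfc k - D.rcfc g) - (k 0 - g 0) *\<^sub>R (e - p)"
      by (simp add: poly[OF g(1), THEN conjunct2] scaleR_diff_left)
    also have "norm \<dots> \<le> \<delta> + \<delta> + \<delta> * norm (e - p)"
      by (intro order_trans[OF norm_triangle_ineq4] add_mono 1 2 3)
    also have "\<dots> = \<epsilon>" using \<delta>(2) by (simp add: K_def algebra_simps)
    finally show ?thesis by simp
  qed
  then have "norm ?x \<le> 0" by (rule field_le_epsilon)
  then show ?thesis by simp
qed

end

section \<open>The equivalence\<close>

lemma GTA_if_WTA:
  fixes A :: "'a::cstar_algebra set"
  assumes W: "A \<in> WTA \<Omega>"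
  shows "A \<in> GTA \<Omega>"
proof -
  have A: "cstar_alg A" "simple A" "unital A" using W by (auto simp: WTA_def)
  then obtain e where e: "is_unit_of e A" by (auto simp: unital_def)
  interpret A: unital_cstar A e using A e by unfold_locales
  show ?thesis
    unfolding GTA_def mem_Collect_eq
  proof (intro conjI allI impI A(1,2))
    fix \<epsilon> :: real and F a b
    assume \<epsilon>: "0 < \<epsilon>" and
      as: "finite F \<and> F \<subseteq> A \<and> a \<in> pos A \<and> norm a = 1 \<and> b \<in> pos A \<and> norm b \<le> 1"
    then have a: "finite F \<and> F \<subseteq> A \<and> a \<in> pos A \<and> a \<noteq> 0" "norm a = 1" by auto
    have b: "b \<in> A" "star b = b" using as by (auto simp: A.pos_iff)
    obtain B p g where B: "cstar_alg B" "B \<subseteq> A" "B \<in> \<Omega>" "is_unit_of p B"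
      and g: "g \<in> pos B" "e - g \<in> pos A"
      and F: "\<forall>x\<in>F. approx_in ((p - g) * x) \<epsilon> B \<and> approx_in (x * (p - g)) \<epsilon> B"
        "\<forall>x\<in>F. norm ((p - g) * x - x * (p - g)) < \<epsilon>"
      and le: "cuntz_le A (e - (p - g)) a"
      and nrm: "norm ((p - g) * a * (p - g)) \<ge> norm a - \<epsilon>"
      using W[unfolded WTA_def mem_Collect_eq, THEN conjunct2, THEN conjunct2, THEN conjunct2,
          rule_format, OF \<epsilon> a(1)]
      unfolding A.unit_of_eq by blast
    interpret S: unital_cstar_subalgebra A B e p using B by unfold_locales
    have gB: "g \<in> B" "star g = g" "g \<in> A" using g B by (auto simp: S.B.pos_iff)
    \<comment> \<open>The bound \<open>g \<le> 1\<close> is given as positivity of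
      \<open>e - g\<close> in \<open>A\<close>. With \<open>z\<close> and \<open>1 - z\<close> both
      nonnegative, it becomes a norm bound, which can be used in \<open>B\<close>.\<close>
    have "cmod z \<le> 1" if z: "z \<in> spectrum A g" for z
    proof -
      have "e - (e - g) = g" by simp
      then have "1 - z \<in> spectrum A (e - g)"
        using A.spectrum_unit_diff[of "e - g" z] z gB by simp
      then have "Im (1 - z) = 0 \<and> 0 \<le> Re (1 - z)" using g(2) by (auto simp only: A.pos_iff)
      moreover have "0 \<le> Re z" using z S.pos_sub[OF g(1)] by (auto simp: A.pos_iff)
      ultimately show ?thesis by (simp add: cmod_eq_Re)
    qed
    then have "norm g \<le> 1" using gB by (intro A.norm_le_of_spectrum) auto
    then have r: "p - g \<in> pos B" "norm (p - g) \<le> 1" using S.B.unit_diff_pos g(1) by auto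
    have rA: "p - g \<in> A" "star (p - g) = p - g" using S.pos_sub[OF r(1)] by (auto simp: A.pos_iff)
    define x where "x = b * (e - (p - g)) * b"
    have x: "x \<in> A" "star x = x"
      using b rA by (simp_all add: x_def star_mult star_diff[of e] mult.assoc)
    \<comment> \<open>Thus the cut-down is \<open>e - (p - g)\<close> conjugated by
      \<open>h * b\<close>, and \<open>cuntz_le_conj\<close> applies once.\<close>
    obtain h where h: "h \<in> A" "star h = h" "pos_cut A x \<epsilon> = h * x * h"
      using A.pos_cut_eq_conj[OF x \<epsilon>] by blast
    have "cuntz_le A ((h * b) * (e - (p - g)) * star (h * b)) a"
      using A.cuntz_le_conj[OF le] h b by simp
    moreover have "(h * b) * (e - (p - g)) * star (h * b) = pos_cut A x \<epsilon>"
      unfolding h(3) by (simp add: h(2) x_def star_mult b mult.assoc)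
    moreover have "b * b - b * (p - g) * b = x"
      using b by (simp add: x_def right_diff_distrib left_diff_distrib)
    ultimately have "cuntz_le A (pos_cut A (b * b - b * (p - g) * b) \<epsilon>) a" by simp
    then show "\<exists>B r. cstar_alg B \<and> B \<subseteq> A \<and> B \<in> \<Omega> \<and> r \<in> pos B \<and> norm r \<le> 1 \<and>
        (\<forall>x\<in>F. approx_in (r * x) \<epsilon> B \<and> approx_in (x * r) \<epsilon> B) \<and>
        (\<forall>x\<in>F. norm (r * x - x * r) < \<epsilon>) \<and>
        cuntz_le A (pos_cut A (b * b - b * r * b) \<epsilon>) a \<and> norm (r * a * r) \<ge> 1 - \<epsilon>"
      using B r F nrm a(2) by (intro exI[of _ B] exI[of _ "p - g"]) simp
  qed
qed

section \<open>From GTA to WTA\<close>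

text \<open>Replacing \<open>r\<close> by \<open>1 - (1 - r - \<delta>)\<^sub>+ / (1 - \<delta>)\<close> moves it by at most \<open>\<delta>\<close> and makes its
  complement in \<open>A\<close> a multiple of the cut-down \<open>(1 - r - \<delta>)\<^sub>+\<close>.\<close>

lemma (in unital_cstar_subalgebra) exists_cut_complement:
  assumes r: "r \<in> pos B" "norm r \<le> 1" and \<delta>: "0 < \<delta>" "\<delta> < 1"
  obtains g where "g \<in> pos B" "norm g \<le> 1" "norm ((p - g) - r) \<le> \<delta>"
    "pos_cut A (e - r) \<delta> = (1 - \<delta>) *\<^sub>R (e - (p - g))"
proof
  have rB: "r \<in> B" "star r = r" "r \<in> A" using r sub_mem by (auto simp: B.pos_iff)
  interpret C: functional_calculus A e "e - r" "cfc A (e - r)"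
    using rB by (intro functional_calculus_cfc) (auto simp: star_diff)
  interpret D: functional_calculus B p r "cfc B r"
    using rB by (intro B.functional_calculus_cfc) auto
  have bound: "0 \<le> Re z \<and> Re z \<le> 1" if "z \<in> spectrum B r" for z
    using that r B.norm_le_of_mem_spectrum[OF rB(1) that] complex_Re_le_cmod[of z]
    by (auto simp: B.pos_iff)
  define k where "k t = max (1 - t - \<delta>) 0" for t :: real
  \<comment> \<open>The factor gives \<open>l 0 = 1\<close>, the value that the complement
    \<open>e - (p - g)\<close> takes on the corner \<open>e - p\<close>.\<close>
  define l where "l t = inverse (1 - \<delta>) * k t" for t
  have k: "continuous_on UNIV k" unfolding k_def by (intro continuous_intros)
  have l: "continuous_on UNIV l" unfolding l_def by (intro continuous_intros k)
  have l01: "0 \<le> l t \<and> l t \<le> 1" if "0 \<le> t" for t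
    using \<delta> that by (auto simp: l_def k_def field_simps max_def)
  \<comment> \<open>Up to \<open>1 - \<delta>\<close> the error is
    \<open>\<delta> * t / (1 - \<delta>)\<close>, largest at the right end; beyond it
    \<open>l\<close> vanishes and the error is \<open>1 - t < \<delta>\<close>.\<close>
  have ldiff: "\<bar>1 - l t - t\<bar> \<le> \<delta>" if t: "0 \<le> t" "t \<le> 1" for t
  proof (cases "t \<le> 1 - \<delta>")
    case True
    have eq: "1 - l t - t = inverse (1 - \<delta>) * (\<delta> * t)"
      using True \<delta> by (simp add: l_def k_def field_simps)
    have "inverse (1 - \<delta>) * (\<delta> * t) \<le> inverse (1 - \<delta>) * (\<delta> * (1 - \<delta>))"
      using True \<delta> by (intro mult_left_mono) auto
    also have "\<dots> = \<delta>" using \<delta> by simp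
    finally show ?thesis unfolding eq using \<delta> t by simp
  next
    case False
    then show ?thesis using t by (simp add: l_def k_def)
  qed
  define g where "g = D.rcfc l"
  have gB: "g \<in> B" "star g = g" using D.rcfc_mem[OF l] D.rcfc_selfadjoint[OF l] by (auto simp: g_def)
  show "g \<in> pos B"
    unfolding B.pos_iff using gB D.spectrum_rcfc[OF l] bound l01 by (fastforce simp: g_def)
  show "norm g \<le> 1"
    unfolding g_def using bound l01 by (intro D.norm_rcfc_le[OF l]) auto
  have "D.rcfc (\<lambda>t. 1 - l t - t) = (p - g) - r"
    by (simp add: D.rcfc_diff l continuous_intros D.rcfc_const D.rcfc_id g_def)
  moreover have "norm (D.rcfc (\<lambda>t. 1 - l t - t)) \<le> \<delta>"
    using bound ldiff \<delta> by (intro D.norm_rcfc_le continuous_intros l) auto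
  ultimately show "norm ((p - g) - r) \<le> \<delta>" by simp
  have kl: "k = (\<lambda>t. (1 - \<delta>) * l t)" using \<delta> by (simp add: l_def fun_eq_iff)
  have "pos_cut A (e - r) \<delta> = C.rcfc (\<lambda>t. k (1 - t))"
    by (simp add: pos_cut_def C.rcfc_def k_def)
  also have "\<dots> = D.rcfc k + k 0 *\<^sub>R (e - p)"
    by (rule rcfc_corner[OF C.functional_calculus_axioms D.functional_calculus_axioms r k])
  also have "D.rcfc k = (1 - \<delta>) *\<^sub>R g"
    unfolding g_def kl by (rule D.rcfc_scaleR[OF l])
  also have "k 0 = 1 - \<delta>" using \<delta> by (simp add: k_def)
  finally show "pos_cut A (e - r) \<delta> = (1 - \<delta>) *\<^sub>R (e - (p - g))"
    by (simp add: algebra_simps)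
qed

lemma approx_in_perturb:
  assumes "approx_in x \<delta> B" "norm (y - x) \<le> \<eta>" "\<eta> + \<delta> \<le> \<epsilon>"
  shows "approx_in y \<epsilon> B"
proof -
  obtain b where b: "b \<in> B" "norm (x - b) < \<delta>" using assms(1) by (auto simp: approx_in_def)
  have "norm (y - b) < \<epsilon>"
    using norm_triangle_ineq[of "y - x" "x - b"] assms(2,3) b(2) by simp
  then show ?thesis using b(1) approx_in_def by blast
qed

lemma WTA_if_GTA:
  fixes A :: "'a::cstar_algebra set"
  assumes G: "A \<in> GTA \<Omega>" and A: "unital A" and \<Omega>: "\<forall>B\<in>\<Omega>. unital B"
  shows "A \<in> WTA \<Omega>"
proof -
  have A': "cstar_alg A" "simple A" using G by (auto simp: GTA_def)
  from A obtain e where e: "is_unit_of e A" by (auto simp: unital_def)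
  interpret A: unital_cstar A e using A' e by unfold_locales
  show ?thesis
    unfolding WTA_def mem_Collect_eq A.unit_of_eq
  proof (intro conjI allI impI A A')
    fix \<epsilon> :: real and F a
    assume \<epsilon>: "0 < \<epsilon>" and as: "finite F \<and> F \<subseteq> A \<and> a \<in> pos A \<and> a \<noteq> 0"
    \<comment> \<open>A common bound for \<open>a\<close> and all of \<open>F\<close>; the summand 1
      ensures \<open>\<delta> \<le> \<delta> * K\<close>.\<close>
    define K where "K = 1 + norm a + (\<Sum>x\<in>F. norm x)"
    have K: "K \<ge> 1" "norm a \<le> K" by (auto simp: K_def sum_nonneg)
    have KF: "norm x \<le> K" if "x \<in> F" for x
      using that as member_le_sum[of x F norm] by (simp add: K_def add_increasing)
    \<comment> \<open>The budget is \<open>3 * (\<delta> * K) \<le> \<epsilon>\<close>: passing from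
      \<open>r\<close> to \<open>p - g\<close> on both sides costs
      \<open>2 * (\<delta> * K)\<close>, and one share is left for the error already present for
      \<open>r\<close>. The bound 1/2 keeps \<open>1 - \<delta>\<close> positive.\<close>
    define \<delta> where "\<delta> = min (1/2) (\<epsilon> / (3 * K))"
    have \<delta>: "0 < \<delta>" "\<delta> < 1" using \<epsilon> K by (auto simp: \<delta>_def)
    have "\<delta> * (3 * K) \<le> \<epsilon> / (3 * K) * (3 * K)"
      using K by (intro mult_right_mono) (auto simp: \<delta>_def)
    then have \<delta>K: "3 * (\<delta> * K) \<le> \<epsilon>" using K by simp
    have \<delta>1: "\<delta> \<le> \<delta> * K" using \<delta> K mult_left_mono[of 1 K \<delta>] by simp
    define a0 where "a0 = (1 / norm a) *\<^sub>R a"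
    have na: "norm a > 0" using as by simp
    have a0: "a0 \<in> pos A" "norm a0 = 1"
      using as A.scaleR_pos[of a "1 / norm a"] by (auto simp: a0_def)
    have "finite F \<and> F \<subseteq> A \<and> a0 \<in> pos A \<and> norm a0 = 1 \<and> e \<in> pos A \<and> norm e \<le> 1"
      using as a0 A.unit_pos A.norm_unit_le by auto
    then obtain B r where B: "cstar_alg B" "B \<subseteq> A" "B \<in> \<Omega>"
      and r: "r \<in> pos B" "norm r \<le> 1"
      and F: "\<forall>x\<in>F. approx_in (r * x) \<delta> B \<and> approx_in (x * r) \<delta> B"
        "\<forall>x\<in>F. norm (r * x - x * r) < \<delta>"
      and le: "cuntz_le A (pos_cut A (e * e - e * r * e) \<delta>) a0"
      and nrm: "norm (r * a0 * r) \<ge> 1 - \<delta>"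
      using G[unfolded GTA_def mem_Collect_eq, THEN conjunct2, THEN conjunct2, rule_format,
          OF \<delta>(1), of F a0 e] by blast
    obtain p where p: "is_unit_of p B" using B(3) \<Omega> by (auto simp: unital_def)
    interpret S: unital_cstar_subalgebra A B e p using B p by unfold_locales
    have rA: "r \<in> A" using S.pos_sub[OF r(1)] by (simp add: A.pos_iff)
    obtain g where g: "g \<in> pos B" "norm g \<le> 1" "norm ((p - g) - r) \<le> \<delta>"
      "pos_cut A (e - r) \<delta> = (1 - \<delta>) *\<^sub>R (e - (p - g))"
      using S.exists_cut_complement[OF r \<delta>] .
    define q where "q = p - g"
    have q: "norm q \<le> 1" "norm (q - r) \<le> \<delta>" using S.B.unit_diff_pos(2) g by (auto simp: q_def)
    have qx: "norm (q * x - r * x) \<le> \<delta> * K" "norm (x * q - x * r) \<le> \<delta> * K" if "norm x \<le> K" for x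
    proof -
      have "norm ((q - r) * x) \<le> \<delta> * K" "norm (x * (q - r)) \<le> K * \<delta>"
        using q \<delta> K that
        by (intro order_trans[OF norm_mult_ineq] mult_mono; simp)+
      then show "norm (q * x - r * x) \<le> \<delta> * K" "norm (x * q - x * r) \<le> \<delta> * K"
        by (simp_all add: left_diff_distrib right_diff_distrib mult.commute)
    qed
    have 1: "approx_in (q * x) \<epsilon> B \<and> approx_in (x * q) \<epsilon> B" if x: "x \<in> F" for x
    proof -
      have "\<delta> * K + \<delta> \<le> \<epsilon>" using \<delta>K \<delta>1 \<delta> by linarith
      then show ?thesis using F(1) x qx[OF KF[OF x]] approx_in_perturb by blast
    qed
    have 2: "norm (q * x - x * q) < \<epsilon>" if x: "x \<in> F" for x
    proof -
      have "q * x - x * q = (q * x - r * x) + (r * x - x * r) - (x * q - x * r)" by simp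
      also have "norm \<dots> \<le> norm (q * x - r * x) + norm (r * x - x * r) + norm (x * q - x * r)"
        by (intro order_trans[OF norm_triangle_ineq4] add_mono norm_triangle_ineq order_refl)
      also have "\<dots> < \<delta> * K + \<delta> + \<delta> * K"
        using qx[OF KF[OF x]] F(2) x by (intro add_less_le_mono add_le_less_mono) auto
      finally show ?thesis using \<delta>K \<delta>1 by (simp add: mult.commute)
    qed
    have 3: "cuntz_le A (e - q) a"
    proof (rule A.cuntz_le_scaleR)
      show "cuntz_le A ((1 - \<delta>) *\<^sub>R (e - q)) ((1 / norm a) *\<^sub>R a)"
        using le g(4) rA by (simp add: a0_def q_def)
    qed (use \<delta> na in auto)
    have 4: "norm (q * a * q) \<ge> norm a - \<epsilon>"
    proof -
      have "r * a * r = norm a *\<^sub>R (r * a0 * r)" using na by (simp add: a0_def)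
      then have "norm a * (1 - \<delta>) \<le> norm (r * a * r)" using nrm na by (simp add: mult_left_mono)
      moreover have "norm (r * a * r - q * a * q) \<le> 2 * (\<delta> * K)"
      proof -
        \<comment> \<open>The middle term is \<open>q * a * r\<close>, so that one factor changes at
          a time.\<close>
        have "r * a * r - q * a * q = - ((q * a - r * a) * r + q * (a * q - a * r))"
          by (simp add: algebra_simps)
        also have "norm \<dots> \<le> norm (q * a - r * a) * norm r + norm q * norm (a * q - a * r)"
          unfolding norm_minus_cancel
          by (intro order_trans[OF norm_triangle_ineq] add_mono norm_mult_ineq)
        also have "\<dots> \<le> (\<delta> * K) * 1 + 1 * (\<delta> * K)"
          using qx[OF K(2)] q r \<delta> K by (intro add_mono mult_mono) auto
        finally show ?thesis by (simp add: mult.commute)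
      qed
      moreover have "norm (r * a * r) \<le> norm (q * a * q) + norm (r * a * r - q * a * q)"
        using norm_triangle_sub by blast
      moreover have "norm a * \<delta> \<le> \<delta> * K" using K \<delta> by simp
      ultimately show ?thesis using \<delta>K by (simp add: right_diff_distrib)
    qed
    \<comment> \<open>The unit of a C*-subalgebra is automatically a self-adjoint
      idempotent.\<close>
    have pr: "projection p" by (simp add: projection_def)
    have eg: "e - g \<in> pos A" using A.unit_diff_pos(1) S.pos_sub g by blast
    show "\<exists>B p g. cstar_alg B \<and> B \<subseteq> A \<and> B \<in> \<Omega> \<and> p \<in> A \<and> projection p \<and> is_unit_of p B \<and>
        g \<in> pos B \<and> e - g \<in> pos A \<and>
        (\<forall>x\<in>F. approx_in ((p - g) * x) \<epsilon> B \<and> approx_in (x * (p - g)) \<epsilon> B) \<and>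
        (\<forall>x\<in>F. norm ((p - g) * x - x * (p - g)) < \<epsilon>) \<and>
        cuntz_le A (e - (p - g)) a \<and> norm ((p - g) * a * (p - g)) \<ge> norm a - \<epsilon>"
      by (rule exI[of _ B], rule exI[of _ p], rule exI[of _ g])
        (use B p pr g(1) eg 1 2 3 4 S.sub_mem in \<open>simp add: q_def\<close>)
  qed
qed

theorem proposition2p3:
  fixes \<Omega> :: "'a::cstar_algebra set set" and A :: "'a set"
  assumes "\<forall>B\<in>\<Omega>. cstar_alg B"
    and "cstar_alg A"
    and "unital A"
    and "\<forall>B\<in>\<Omega>. unital B"
  shows "A \<in> WTA \<Omega> \<longleftrightarrow> A \<in> GTA \<Omega>"
  using GTA_if_WTA WTA_if_GTA assms by blast

end
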